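(* Let $W^{\mathrm{pol}}(\cdot,t)\approx W(\cdot,t)$, $$W^{\mathrm{pol}}(x,t)=\sum_{\mathbf r\in\mathcal R}\alpha_{\mathbf r}(t)\prod_{l=1}^N T_{r_l}(x_l/L),$$ be the Chebyshev interpolation polynomial of the potential $W$ on $\Omega=[-L,L]^N$ over the index set $\mathcal R=\mathcal R(R)$, for fixed $L$, where $L\ge\sqrt{2(K+1)}+1$. Let $\mathcal K=\mathcal K(K)$ be a hyperbolically reduced index set with $K\gg R$. Suppose that $v\in\mathbb C^{|\mathcal K|}$ has componentwise decay of order $\beta\in\mathbb N$, i.e. $$v_{\mathbf k}=\mathcal O\Big(\prod_{l=1}^N\max(k_l,1)^{-\beta}\Big),\qquad \mathbf k\in\mathcal K .$$ Then the error due to quadrature behaves as $$\left|\left(\left(\mathcal W_{\mathcal K,\mathrm{pol}}(t)-\mathcal W^{\mathrm{GH}(K)}_{\mathcal K,\mathrm{pol}}(t)\right)v\right)_{\mathbf j}\right|\le C(\mathcal R,W,L,t)\,K^{-\beta},\qquad \mathbf j\in\mathcal K .$$ The constant $C(\mathcal R,W,L,t)$ behaves as $$C(\mathcal R,W,L,t)=\sum_{\mathbf r\in\mathcal R}|\alpha_{\mathbf r}(t)|\,\frac14\,r_{\max}^2(r_{\max}-1)\binom{r_{\max}}{\lfloor r_{\max}/2-1\rfloor_+},\qquad r_{\max}=r_{\max}(\mathbf r)=\max_{1\le l\le N}r_l,$$ and depends only on $\mathcal R$, the regularity of $W$, $L$, and time $t$.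
   Context: $\mathbb N=\{0,1,2,\dots\}$, $a_+=\max(a,0)$, $N\ge1$ is the spatial dimension, and $(f,g)=\int_{\mathbb R^N} f\,\overline g\,dx$. Hermite functions: $\varphi_k(x)=\pi^{-1/4}(2^kk!)^{-1/2}H_k(x)e^{-x^2/2}$ for $k\ge0$, with $H_k$ the classical (physicists') Hermite polynomial of degree $k$; they are orthonormal in $L^2(\mathbb R)$. For $\mathbf k=(k_1,\dots,k_N)\in\mathbb N^N$, $\varphi_{\mathbf k}(x)=\prod_{l=1}^N\varphi_{k_l}(x_l)$. Index sets: $\mathcal R(R)\subseteq\{0,\dots,R\}^N$ is the index set of the polynomial interpolation, with maximal univariate degree $R$. The hyperbolically reduced index set is $\mathcal K(K)=\{\mathbf k\in\mathbb N^N:\prod_{l=1}^N(1+k_l)\le K+1\}$. Vectors in $\mathbb C^{|\mathcal K|}$ and matrices are indexed by elements of $\mathcal K$. The condition $K\gg R$ means that $K$ is much larger than $R$. $T_r$ is the Chebyshev polynomial of the first kind of degree $r$. The potential $W(\cdot,t)$ is a possibly time-dependent multiplicative potential, assumed sufficiently regular on $\Omega$. The interpolation coefficients $\alpha_{\mathbf r}(t)$ depend on $L$ but not on $K$. As a polynomial, $W^{\mathrm{pol}}$ is regarded as defined on all of $\mathbb R^N$. Galerkin matrix: $(\mathcal W_{\mathcal K,\mathrm{pol}}(t))_{\mathbf j\mathbf k}=(\varphi_{\mathbf j},W^{\mathrm{pol}}(\cdot,t)\varphi_{\mathbf k})$, $\mathbf j,\mathbf k\in\mathcal K$ (integrals over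 $\mathbb R^N$). Gauss--Hermite approximation: let $\xi_0,\dots,\xi_K$ be the zeros of $H_{K+1}$ and $w_0,\dots,w_K$ the corresponding Gauss quadrature weights for the weight function $e^{-x^2}$ on $\mathbb R$ (exact for polynomials of degree $\le 2K+1$). For $\mathbf m\in\{0,\dots,K\}^N$ put $\xi_{\mathbf m}=(\xi_{m_1},\dots,\xi_{m_N})$ and $\omega_{\mathbf m}=\prod_{l=1}^N w_{m_l}e^{\xi_{m_l}^2}$. Then $$(\mathcal W^{\mathrm{GH}(K)}_{\mathcal K,\mathrm{pol}}(t))_{\mathbf j\mathbf k}=\sum_{\mathbf m\in\{0,\dots,K\}^N}\omega_{\mathbf m}\,\varphi_{\mathbf j}(\xi_{\mathbf m})\,W^{\mathrm{pol}}(\xi_{\mathbf m},t)\,\varphi_{\mathbf k}(\xi_{\mathbf m}),\qquad \mathbf j,\mathbf k\in\mathcal K .$$ *)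

theory Defs
  imports "HOL-Analysis.Analysis" "HOL-Computational_Algebra.Polynomial"
begin

text \<open>Physicists' normalisation: leading coefficient \<open>2 ^ n\<close>, orthogonal for the weight \<open>exp (- x\<^sup>2)\<close>.\<close>

fun hermite_poly :: "nat \<Rightarrow> real poly" where
  "hermite_poly 0 = 1"
| "hermite_poly (Suc 0) = [:0, 2:]"
| "hermite_poly (Suc (Suc n)) =
     [:0, 2:] * hermite_poly (Suc n) - smult (2 * real (Suc n)) (hermite_poly n)"

definition hermite_fun1 :: "nat \<Rightarrow> real \<Rightarrow> real" where
  "hermite_fun1 k x =
     pi powr (- 1 / 4) / sqrt (2 ^ k * fact k) * poly (hermite_poly k) x * exp (- x\<^sup>2 / 2)"

definition hermite_fun :: "nat ^ 'n::finite \<Rightarrow> real ^ 'n \<Rightarrow> real" where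
  "hermite_fun k x = (\<Prod>l\<in>UNIV. hermite_fun1 (k $ l) (x $ l))"

definition l2_inner :: "(real ^ 'n::finite \<Rightarrow> complex) \<Rightarrow> (real ^ 'n \<Rightarrow> complex) \<Rightarrow> complex" where
  "l2_inner f g = (LINT x|lborel. f x * cnj (g x))"

definition hyp_index :: "nat \<Rightarrow> (nat ^ 'n::finite) set" where
  "hyp_index K = {k. (\<Prod>l\<in>UNIV. 1 + k $ l) \<le> K + 1}"

definition cube_index :: "nat \<Rightarrow> (nat ^ 'n::finite) set" where
  "cube_index K = {m. \<forall>l. m $ l \<le> K}"

fun chebyshev_poly :: "nat \<Rightarrow> real poly" where
  "chebyshev_poly 0 = 1"
| "chebyshev_poly (Suc 0) = [:0, 1:]"
| "chebyshev_poly (Suc (Suc n)) = [:0, 2:] * chebyshev_poly (Suc n) - chebyshev_poly n"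

definition cheb_expansion ::
    "real \<Rightarrow> (nat ^ 'n::finite) set \<Rightarrow> (nat ^ 'n \<Rightarrow> real) \<Rightarrow> real ^ 'n \<Rightarrow> real" where
  "cheb_expansion L \<R> a x =
     (\<Sum>r\<in>\<R>. a r * (\<Prod>l\<in>UNIV. poly (chebyshev_poly (r $ l)) (x $ l / L)))"

text \<open>
  Chebyshev points in \<open>[-1, 1]\<close> are either the zeros of a Chebyshev polynomial or its extrema
  (Gauss or Gauss--Lobatto points).
\<close>

definition chebyshev_point :: "real \<Rightarrow> bool" where
  "chebyshev_point y \<longleftrightarrow>
     (\<exists>n i. i < n \<and> y = cos (real (2 * i + 1) * pi / real (2 * n))) \<or>
     (\<exists>n i. 1 \<le> n \<and> i \<le> n \<and> y = cos (real i * pi / real n))"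

text \<open>
  The coefficients \<open>a\<close> are those of the Chebyshev interpolation polynomial of \<open>f\<close> on
  \<open>[-L, L]\<^sup>N\<close> over the index set \<open>\<R>\<close>. As \<open>\<R>\<close> may be a full cube or
  any reduced index set, the grid \<open>Y\<close> is only required to consist of scaled Chebyshev points, as many
  as there are indices, on which the interpolation problem is uniquely solvable.
\<close>

definition chebyshev_interpolation ::
    "real \<Rightarrow> (nat ^ 'n::finite) set \<Rightarrow> (real ^ 'n \<Rightarrow> real) \<Rightarrow> (nat ^ 'n \<Rightarrow> real) \<Rightarrow> bool" where
  "chebyshev_interpolation L \<R> f a \<longleftrightarrow>
     (\<exists>Y. finite Y \<and> card Y = card \<R> \<and>
          (\<forall>y\<in>Y. \<forall>l. chebyshev_point (y $ l / L)) \<and>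
          (\<forall>b. (\<forall>y\<in>Y. cheb_expansion L \<R> b y = 0) \<longrightarrow> (\<forall>r\<in>\<R>. b r = 0)) \<and>
          (\<forall>y\<in>Y. cheb_expansion L \<R> a y = f y))"

definition galerkin_matrix ::
    "(real ^ 'n::finite \<Rightarrow> real) \<Rightarrow> nat ^ 'n \<Rightarrow> nat ^ 'n \<Rightarrow> complex" where
  "galerkin_matrix W j k =
     l2_inner (\<lambda>x. complex_of_real (hermite_fun j x))
              (\<lambda>x. complex_of_real (W x * hermite_fun k x))"

definition gh_node :: "nat \<Rightarrow> nat \<Rightarrow> real" where
  "gh_node K m = sorted_list_of_set {x. poly (hermite_poly (K + 1)) x = 0} ! m"

text \<open>Gauss quadrature is interpolatory, so its weights are the integrals of the Lagrange basis polynomials.\<close>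

definition gh_weight :: "nat \<Rightarrow> nat \<Rightarrow> real" where
  "gh_weight K m =
     (LINT x|lborel. (\<Prod>i\<in>{0..K} - {m}. (x - gh_node K i) / (gh_node K m - gh_node K i))
        * exp (- x\<^sup>2))"

definition gh_grid_node :: "nat \<Rightarrow> nat ^ 'n::finite \<Rightarrow> real ^ 'n" where
  "gh_grid_node K m = (\<chi> l. gh_node K (m $ l))"

definition gh_grid_weight :: "nat \<Rightarrow> nat ^ 'n::finite \<Rightarrow> real" where
  "gh_grid_weight K m = (\<Prod>l\<in>UNIV. gh_weight K (m $ l) * exp ((gh_node K (m $ l))\<^sup>2))"

definition gh_matrix ::
    "nat \<Rightarrow> (real ^ 'n::finite \<Rightarrow> real) \<Rightarrow> nat ^ 'n \<Rightarrow> nat ^ 'n \<Rightarrow> complex" where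
  "gh_matrix K W j k =
     complex_of_real (\<Sum>m\<in>cube_index K. gh_grid_weight K m * hermite_fun j (gh_grid_node K m)
        * W (gh_grid_node K m) * hermite_fun k (gh_grid_node K m))"

definition r_max :: "nat ^ 'n::finite \<Rightarrow> nat" where
  "r_max r = Max (range (\<lambda>l. r $ l))"

text \<open>The positive part of the floor is taken by the truncation in \<^const>\<open>nat\<close>.\<close>

definition quad_const :: "(nat ^ 'n::finite) set \<Rightarrow> (nat ^ 'n \<Rightarrow> real) \<Rightarrow> real" where
  "quad_const \<R> a =
     (\<Sum>r\<in>\<R>. \<bar>a r\<bar> * (1 / 4 * (real (r_max r))\<^sup>2 * (real (r_max r) - 1)
        * real (r_max r choose nat \<lfloor>real (r_max r) / 2 - 1\<rfloor>)))"

end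

(* Both matrices are sums over r of tensor products of univariate entries (phi_j, T_r(./L) phi_k),
   computed exactly or by quadrature. A univariate quadrature is inexact only if
   j + k + r >= 2K + 2; by the hyperbolic cut-off this can happen in at most one coordinate direction,
   the other coordinates of the indices j and k then being 0. The remaining factors are
   quadrature values with nodes in [-L, L], hence bounded by 1.
   In the critical direction only the r - 1 indices k > K + 1 - r contribute, and there
   k^-beta is comparable to K^-beta. A quadrature entry is bounded by 1. An exact entry is also a quadrature
   value, with K + r + 1 nodes; these leave [-L, L] by a factor close to 1 only, where T_r grows
   like 1.03^r. For r >= 3 this is absorbed by the binomial coefficient, and for r = 2 the error
   is computed to be (K + 1) / L^2. *)

theory Submission
  imports Defs "HOL-Probability.Distributions"
begin

subsection \<open>Gaussian integrals and Hermite polynomials\<close>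

text \<open>The obstacle is the exact entries. Reading K >> R as K >= rho * R, with rho depending on
  beta only, leaves the auxiliary nodes a relative excess of order 1/rho over L, and T_r at 1 + eps
  can grow like exp(r * sqrt(2 * eps)). A linear condition thus cannot keep this bound independent
  of r; the binomial coefficient has to pay for it, being at least 2^h for h = r div 2 - 1. No
  pointwise estimates of Hermite functions enter: positive weights and exactly integrated squares
  bound every quadrature value by the maximum of |T_r| over the nodes, so that only the location of
  the nodes matters. In rho = 1300 + 15 * beta the term 1300 keeps the excess within what the base
  1.03 allows, and 15 * beta limits (K / k)^beta to 15/14. The numbers are matched at r = 3, where
  2.1 * (15/14) = 9/4 = r^2/4. For r <= 1 the constant is 0 and the rule is exact; for r = 2 the
  constant is 1, below what the general estimate yields, hence the explicit computation.\<close>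

definition herm_int :: "real poly \<Rightarrow> real" where
  "herm_int p = (LINT x|lborel. poly p x * exp (- x\<^sup>2))"

text \<open>Variance 1/2 is the case in which the known moments of the normal law become those of
  the weight exp(-x^2).\<close>

lemma normal_density_sqrt_half:
  "normal_density 0 (sqrt (1 / 2)) x = exp (- x\<^sup>2) / sqrt pi"
  by (simp add: normal_density_def)

lemma has_integral_gauss_even:
  "has_bochner_integral lborel (\<lambda>x. x ^ (2 * k) * exp (- x\<^sup>2)) (sqrt pi * fact (2 * k) / (4 ^ k * fact k))"
proof -
  have "has_bochner_integral lborel (\<lambda>x. sqrt pi * (normal_density 0 (sqrt (1 / 2)) x * (x - 0) ^ (2 * k)))
     (sqrt pi * (fact (2 * k) / ((2 / (sqrt (1 / 2))\<^sup>2) ^ k * fact k)))"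
    by (intro has_bochner_integral_mult_right normal_moment_even) simp
  then show ?thesis
    unfolding normal_density_sqrt_half by (simp add: field_simps)
qed

lemma has_integral_gauss_odd:
  "has_bochner_integral lborel (\<lambda>x::real. x ^ (2 * k + 1) * exp (- x\<^sup>2)) 0"
proof -
  have "has_bochner_integral lborel (\<lambda>x. sqrt pi * (normal_density 0 (sqrt (1 / 2)) x * (x - 0) ^ (2 * k + 1)))
     (sqrt pi * 0)"
    by (intro has_bochner_integral_mult_right normal_moment_odd) simp
  then show ?thesis
    unfolding normal_density_sqrt_half by (simp add: field_simps)
qed

lemma integrable_power_gauss: "integrable lborel (\<lambda>x::real. x ^ n * exp (- x\<^sup>2))"
proof (cases "even n")
  case True
  then show ?thesis
    using integrable.intros[OF has_integral_gauss_even] by (auto elim: evenE)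
next
  case False
  then show ?thesis
    using integrable.intros[OF has_integral_gauss_odd] by (auto elim: oddE)
qed

lemma integrable_poly_gauss: "integrable lborel (\<lambda>x::real. poly p x * exp (- x\<^sup>2))"
proof -
  have "(\<lambda>x. poly p x * exp (- x\<^sup>2)) = (\<lambda>x. \<Sum>i\<le>degree p. coeff p i * (x ^ i * exp (- x\<^sup>2)))"
    by (simp add: poly_altdef sum_distrib_right mult.assoc)
  moreover have "integrable lborel (\<lambda>x. \<Sum>i\<le>degree p. coeff p i * (x ^ i * exp (- x\<^sup>2)))"
    by (intro Bochner_Integration.integrable_sum integrable_mult_right integrable_power_gauss)
  ultimately show ?thesis by simp
qed

lemma herm_int_add: "herm_int (p + q) = herm_int p + herm_int q"
  unfolding herm_int_def by (simp add: distrib_right integrable_poly_gauss)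

lemma herm_int_smult: "herm_int (smult c p) = c * herm_int p"
  unfolding herm_int_def by (simp add: mult.assoc)

lemma herm_int_0 [simp]: "herm_int 0 = 0"
  by (simp add: herm_int_def)

lemma herm_int_diff: "herm_int (p - q) = herm_int p - herm_int q"
  unfolding herm_int_def by (simp add: left_diff_distrib integrable_poly_gauss)

lemma herm_int_sum: "herm_int (\<Sum>i\<in>A. f i) = (\<Sum>i\<in>A. herm_int (f i))"
  by (induction A rule: infinite_finite_induct) (simp_all add: herm_int_add)

lemma herm_int_monom_even:
  "herm_int (monom c (2 * k)) = c * (sqrt pi * fact (2 * k) / (4 ^ k * fact k))"
proof -
  have "herm_int (monom c (2 * k)) = (LINT x|lborel. c * (x ^ (2 * k) * exp (- x\<^sup>2)))"
    by (simp add: herm_int_def poly_monom mult.assoc)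
  also have "\<dots> = c * (LINT x|lborel. x ^ (2 * k) * exp (- x\<^sup>2))"
    by simp
  finally show ?thesis
    using has_bochner_integral_integral_eq[OF has_integral_gauss_even[of k]] by simp
qed

lemma herm_int_monom_odd: "herm_int (monom c (Suc (2 * k))) = 0"
proof -
  have "herm_int (monom c (Suc (2 * k))) = (LINT x|lborel. c * (x ^ (2 * k + 1) * exp (- x\<^sup>2)))"
    by (simp add: herm_int_def poly_monom mult.assoc)
  also have "\<dots> = c * (LINT x|lborel. x ^ (2 * k + 1) * exp (- x\<^sup>2))"
    by (rule integral_mult_right_zero)
  finally show ?thesis
    using has_bochner_integral_integral_eq[OF has_integral_gauss_odd[of k]] by simp
qed

lemma herm_int_1: "herm_int 1 = sqrt pi"
  using herm_int_monom_even[of 1 0] by simp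

text \<open>Integration by parts against exp(-x^2), read off from the moments so that no boundary
  terms occur. For even n both sides are odd moments; for odd n = 2k + 1 the moments of order 2k + 2
  and 2k have ratio (2k + 1)/2.\<close>

lemma herm_int_pderiv_monom: "herm_int (pderiv (monom c n)) = herm_int ([:0, 2:] * monom c n)"
proof -
  have *: "[:0, 2:] * monom c n = monom (2 * c) (Suc n)"
    by (simp add: monom_Suc smult_monom)
  show ?thesis
  proof (cases "even n")
    case True
    then obtain k where n: "n = 2 * k" by (elim evenE)
    have "herm_int (pderiv (monom c n)) = 0"
    proof (cases k)
      case 0
      then show ?thesis by (simp add: n pderiv_monom)
    next
      case (Suc i)
      then show ?thesis
        using herm_int_monom_odd[of "of_nat n * c" i] by (simp add: n pderiv_monom)
    qed
    then show ?thesis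
      unfolding * using herm_int_monom_odd[of "2 * c" k] by (simp add: n)
  next
    case False
    then obtain k where n: "n = 2 * k + 1" by (elim oddE)
    have 1: "herm_int (pderiv (monom c n)) = (real n * c) * (sqrt pi * fact (2 * k) / (4 ^ k * fact k))"
      using herm_int_monom_even[of "of_nat n * c" k] by (simp add: n pderiv_monom)
    have 2: "herm_int (monom (2 * c) (Suc n)) = 2 * c * (sqrt pi * fact (2 * Suc k) / (4 ^ Suc k * fact (Suc k)))"
      using herm_int_monom_even[of "2 * c" "Suc k"] by (simp add: n)
    have "fact (2 * Suc k) = real (2 * k + 2) * real (2 * k + 1) * fact (2 * k)"
      by (simp add: algebra_simps)
    then show ?thesis
      unfolding * 1 2 by (simp add: n divide_simps)
  qed
qed

lemma herm_int_pderiv: "herm_int (pderiv p) = herm_int ([:0, 2:] * p)"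
proof -
  have p: "p = (\<Sum>i\<le>degree p. monom (coeff p i) i)"
    by (simp add: poly_as_sum_of_monoms)
  have pderiv_sum: "pderiv (\<Sum>i\<in>A. f i) = (\<Sum>i\<in>A. pderiv (f i))" for A :: "nat set" and f :: "nat \<Rightarrow> real poly"
    by (induction A rule: infinite_finite_induct) (simp_all add: pderiv_add)
  have "herm_int (pderiv p) = (\<Sum>i\<le>degree p. herm_int (pderiv (monom (coeff p i) i)))"
    by (subst p) (simp only: pderiv_sum herm_int_sum)
  also have "\<dots> = (\<Sum>i\<le>degree p. herm_int ([:0, 2:] * monom (coeff p i) i))"
    by (simp only: herm_int_pderiv_monom)
  also have "\<dots> = herm_int ([:0, 2:] * p)"
    by (subst (2) p) (simp only: sum_distrib_left herm_int_sum)
  finally show ?thesis .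
qed

section \<open>Differentiation rules, orthogonality and norms of the Hermite polynomials\<close>

lemma pderiv_hermite_poly: "pderiv (hermite_poly (Suc n)) = smult (2 * real (Suc n)) (hermite_poly n)"
proof (induction n rule: hermite_poly.induct)
  case 1
  show ?case by (simp add: pderiv_pCons)
next
  case 2
  show ?case by (simp add: pderiv_pCons)
next
  case (3 n)
  have "pderiv (hermite_poly (Suc (Suc (Suc n)))) =
      [:2:] * hermite_poly (Suc (Suc n)) + [:0, 2:] * pderiv (hermite_poly (Suc (Suc n)))
      - smult (2 * real (Suc (Suc n))) (pderiv (hermite_poly (Suc n)))"
    by (subst hermite_poly.simps(3)) (simp add: pderiv_diff pderiv_mult pderiv_smult pderiv_pCons del: hermite_poly.simps mult_pCons_left mult_pCons_right)
  also have "\<dots> = smult 2 (hermite_poly (Suc (Suc n))) + smult (2 * real (Suc (Suc n)))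
      ([:0, 2:] * hermite_poly (Suc n) - smult (2 * real (Suc n)) (hermite_poly n))"
    unfolding 3 by (simp add: smult_diff_right del: hermite_poly.simps of_nat_Suc)
  also have "\<dots> = smult (2 * real (Suc (Suc (Suc n)))) (hermite_poly (Suc (Suc n)))"
    unfolding hermite_poly.simps(3)[symmetric] by (simp add: smult_add_left[symmetric] del: hermite_poly.simps)
  finally show ?case .
qed

lemma hermite_poly_Suc: "hermite_poly (Suc n) = [:0, 2:] * hermite_poly n - pderiv (hermite_poly n)"
  by (cases n) (simp_all add: pderiv_hermite_poly one_pCons)

text \<open>The raising relation says H_{n+1} exp(-x^2) = -(H_n exp(-x^2))', so lowering the index
  by one integrates by parts and differentiates \<open>q\<close> once.\<close>

lemma herm_int_hermite_Suc: "herm_int (hermite_poly (Suc n) * q) = herm_int (hermite_poly n * pderiv q)"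
proof -
  have "hermite_poly (Suc n) * q =
      [:0, 2:] * (hermite_poly n * q) - (pderiv (hermite_poly n * q) - hermite_poly n * pderiv q)"
    unfolding hermite_poly_Suc pderiv_mult by (simp add: algebra_simps)
  then show ?thesis
    by (simp only: herm_int_diff herm_int_pderiv)
qed

text \<open>Each lowering of the index differentiates \<open>q\<close>, which is annihilated by the
  time the index reaches 0.\<close>

lemma herm_int_orthogonal: "degree q < n \<Longrightarrow> herm_int (hermite_poly n * q) = 0"
proof (induction n arbitrary: q)
  case (Suc n)
  show ?case
  proof (cases "degree q = 0")
    case True
    then have "pderiv q = 0" by (simp add: pderiv_eq_0_iff)
    then show ?thesis by (simp add: herm_int_hermite_Suc del: hermite_poly.simps)
  next
    case False
    then show ?thesis
      using Suc by (simp add: herm_int_hermite_Suc degree_pderiv del: hermite_poly.simps)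
  qed
qed simp

lemma herm_int_hermite_square: "herm_int (hermite_poly n * hermite_poly n) = sqrt pi * 2 ^ n * fact n"
proof (induction n)
  case 0
  show ?case by (simp add: herm_int_1)
next
  case (Suc n)
  then show ?case
    by (simp add: herm_int_hermite_Suc pderiv_hermite_poly herm_int_smult del: hermite_poly.simps)
qed

lemma degree_coeff_hermite_poly: "degree (hermite_poly n) \<le> n \<and> coeff (hermite_poly n) n = 2 ^ n"
proof (induction n rule: hermite_poly.induct)
  case (3 n)
  have "degree ([:0, 2:] * hermite_poly (Suc n)) \<le> Suc (Suc n)"
    using 3 by (intro order.trans[OF degree_mult_le]) auto
  moreover have "degree (smult (2 * real (Suc n)) (hermite_poly n)) \<le> Suc (Suc n)"
    using 3 by (intro order.trans[OF degree_smult_le]) auto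
  ultimately have "degree (hermite_poly (Suc (Suc n))) \<le> Suc (Suc n)"
    unfolding hermite_poly.simps(3) by (rule degree_diff_le)
  moreover have "coeff (hermite_poly n) (Suc (Suc n)) = 0"
    using 3 by (intro coeff_eq_0) auto
  then have "coeff (hermite_poly (Suc (Suc n))) (Suc (Suc n)) = 2 ^ Suc (Suc n)"
    using 3 by (simp add: coeff_pCons)
  ultimately show ?case by blast
qed simp_all

lemma degree_hermite_poly: "degree (hermite_poly n) = n"
  using degree_coeff_hermite_poly[of n] by (intro antisym le_degree) auto

section \<open>Number and location of the zeros of the Hermite polynomials\<close>

lemma hermite_poly_nonzero: "hermite_poly n \<noteq> 0"
  using degree_coeff_hermite_poly[of n] by auto

text \<open>By the three-term recurrence a common zero of two neighbours would descend to H_0 =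
  1.\<close>

lemma hermite_poly_no_common_root:
  "poly (hermite_poly (Suc n)) x = 0 \<Longrightarrow> poly (hermite_poly n) x \<noteq> 0"
  by (induction n) auto

lemma hermite_poly_simple_root:
  assumes "poly (hermite_poly n) x = 0"
  shows "poly (pderiv (hermite_poly n)) x \<noteq> 0"
proof (cases n)
  case 0
  with assms show ?thesis by simp
next
  case (Suc m)
  then show ?thesis
    using assms hermite_poly_no_common_root[of m x]
    by (simp add: pderiv_hermite_poly del: hermite_poly.simps)
qed

lemma hermite_poly_minus: "poly (hermite_poly n) (- x) = (- 1) ^ n * poly (hermite_poly n) x"
  by (induction n rule: hermite_poly.induct) (simp_all add: algebra_simps)

text \<open>For x^2 >= 2n the subtracted term of the recurrence, 2(k + 1) H_k, is at most x^2 H_k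
  and hence at most x H_{k+1}, which is half of the leading term 2x H_{k+1}. The growth condition
  therefore reproduces itself.\<close>

lemma hermite_poly_growth:
  assumes "x > 0" "x\<^sup>2 \<ge> 2 * real n" "k \<le> n"
  shows "poly (hermite_poly k) x > 0 \<and> poly (hermite_poly (Suc k)) x \<ge> x * poly (hermite_poly k) x"
  using assms(3)
proof (induction k)
  case 0
  then show ?case using assms by simp
next
  case (Suc k)
  define a where "a = poly (hermite_poly k) x"
  define b where "b = poly (hermite_poly (Suc k)) x"
  have IH: "a > 0" "b \<ge> x * a"
    using Suc unfolding a_def b_def by auto
  have b: "b > 0"
    using IH assms(1) mult_pos_pos[of x a] by linarith
  have "2 * real (Suc k) * a \<le> x\<^sup>2 * a"
    using IH assms(2) Suc.prems by (intro mult_right_mono) auto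
  also have "\<dots> \<le> x * b"
    using IH assms(1) by (simp add: power2_eq_square)
  finally have "poly (hermite_poly (Suc (Suc k))) x \<ge> x * b"
    unfolding a_def b_def by simp
  then show ?case using b unfolding b_def by simp
qed

lemma hermite_poly_root_bound:
  assumes "poly (hermite_poly (Suc n)) x = 0"
  shows "x\<^sup>2 \<le> 2 * real n"
proof (rule ccontr)
  assume "\<not> ?thesis"
  then have x: "\<bar>x\<bar> > 0" "\<bar>x\<bar>\<^sup>2 \<ge> 2 * real n"
    by (auto intro!: Nat.gr0I)
  have "poly (hermite_poly n) \<bar>x\<bar> > 0 \<and> poly (hermite_poly (Suc n)) \<bar>x\<bar> \<ge> \<bar>x\<bar> * poly (hermite_poly n) \<bar>x\<bar>"
    by (rule hermite_poly_growth[OF x]) simp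
  then have "poly (hermite_poly (Suc n)) \<bar>x\<bar> > 0"
    using x(1) mult_pos_pos[of "\<bar>x\<bar>" "poly (hermite_poly n) \<bar>x\<bar>"] by linarith
  then show False
    using assms hermite_poly_minus[of "Suc n" x]
    by (auto simp: abs_if split: if_splits simp del: hermite_poly.simps)
qed

lemma herm_int_pos:
  assumes "\<And>x. poly p x \<ge> 0" "p \<noteq> 0"
  shows "herm_int p > 0"
proof -
  have nn: "herm_int p \<ge> 0"
    unfolding herm_int_def by (rule integral_nonneg_AE) (simp add: assms)
  moreover have "herm_int p \<noteq> 0"
  proof
    assume "herm_int p = 0"
    then have "AE x in lborel. poly p x * exp (- x\<^sup>2) = 0"
      unfolding herm_int_def
      by (subst (asm) integral_nonneg_eq_0_iff_AE) (auto simp: assms integrable_poly_gauss)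
    then have "AE x in lborel. poly p x = 0"
      by simp
    moreover have "AE x in lborel. x \<notin> {x. poly p x = 0}"
      using poly_roots_finite[OF assms(2)]
      by (intro AE_not_in finite_imp_null_set_lborel)
    ultimately have "AE x in (lborel :: real measure). False"
      by eventually_elim simp
    then have "ae_filter (lborel :: real measure) = bot"
      by (simp only: eventually_False)
    then show False
      by (simp add: ae_filter_eq_bot_iff)
  qed
  ultimately show ?thesis by simp
qed

lemma poly_no_root_sign:
  fixes g :: "real poly"
  assumes "\<And>x. poly g x \<noteq> 0"
  shows "(\<forall>x. poly g x > 0) \<or> (\<forall>x. poly g x < 0)"
proof (rule ccontr)
  assume "\<not> ?thesis"
  then obtain x y where "poly g x < 0" "poly g y > 0"
    using assms by (meson linorder_neqE_linordered_idom)
  then show False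
    using poly_IVT_pos[of x y g] poly_IVT_neg[of y x g] assms
    by (metis linorder_neqE_linordered_idom not_less_iff_gr_or_eq)
qed

lemma prod_linear_dvd:
  fixes p :: "real poly"
  assumes "finite Z" "\<And>z. z \<in> Z \<Longrightarrow> poly p z = 0"
  shows "(\<Prod>z\<in>Z. [:- z, 1:]) dvd p"
  using assms
proof (induction Z)
  case (insert a Z)
  then obtain g where g: "p = (\<Prod>z\<in>Z. [:- z, 1:]) * g" by (auto elim: dvdE)
  have "poly (\<Prod>z\<in>Z. [:- z, 1:]) a \<noteq> 0"
    using insert.hyps by (auto simp: poly_prod)
  then have "poly g a = 0"
    using insert.prems[of a] by (simp add: g)
  then have "[:- a, 1:] dvd g" by (simp add: poly_eq_0_iff_dvd)
  then show ?case
    using insert.hyps by (simp add: g mult.commute mult_dvd_mono del: mult_pCons_left mult_pCons_right)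
qed simp

text \<open>With q the product over the distinct real zeros, H = q * g. Zeros of H are simple, so g
  has no real zero and a constant sign; thus q^2 g = H q has a nonzero Gaussian integral, and
  orthogonality forces degree q >= n.\<close>

lemma card_hermite_roots: "card {x. poly (hermite_poly n) x = 0} = n"
proof -
  define H where "H = hermite_poly n"
  define Z where "Z = {x. poly H x = 0}"
  have H0: "H \<noteq> 0" by (simp add: H_def hermite_poly_nonzero)
  have fin: "finite Z" unfolding Z_def by (rule poly_roots_finite[OF H0])
  have le: "card Z \<le> n"
    unfolding Z_def using card_poly_roots_bound[OF H0] by (simp add: H_def degree_hermite_poly)
  define q where "q = (\<Prod>z\<in>Z. [:- z, 1:])"
  have deg: "degree q = card Z"
    unfolding q_def by (subst degree_prod_eq_sum_degree) auto
  have "q dvd H"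
    unfolding q_def by (rule prod_linear_dvd[OF fin]) (simp add: Z_def)
  then obtain g where g: "H = q * g" by (elim dvdE)
  have "poly g x \<noteq> 0" for x
  proof
    assume gx: "poly g x = 0"
    then have Hx: "poly H x = 0" by (simp add: g)
    then have "poly q x = 0"
      unfolding q_def poly_prod using fin by (intro prod_zero) (auto simp: Z_def)
    then have "poly (pderiv H) x = 0"
      using gx by (simp add: g pderiv_mult)
    then show False
      using hermite_poly_simple_root[of n x] Hx by (simp add: H_def)
  qed
  then have sgn: "(\<forall>x. poly g x > 0) \<or> (\<forall>x. poly g x < 0)"
    by (rule poly_no_root_sign)
  have nz: "q * q * g \<noteq> 0"
    using H0 by (simp add: g)
  have "herm_int (q * q * g) \<noteq> 0"
    using sgn
  proof
    assume "\<forall>x. poly g x > 0"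
    then have "herm_int (q * q * g) > 0"
      by (intro herm_int_pos nz) (simp add: mult_nonneg_nonneg less_imp_le)
    then show ?thesis by simp
  next
    assume neg: "\<forall>x. poly g x < 0"
    have "poly (smult (- 1) (q * q * g)) x \<ge> 0" for x
      using neg mult_nonneg_nonneg[of "poly q x * poly q x" "- poly g x"] by (simp add: less_imp_le)
    then have "herm_int (smult (- 1) (q * q * g)) > 0"
      by (rule herm_int_pos) (use nz in simp)
    then show ?thesis by (simp only: herm_int_smult)
  qed
  moreover have "q * q * g = H * q" by (simp add: g)
  ultimately have "\<not> degree q < n"
    using herm_int_orthogonal[of q n] by (auto simp: H_def)
  then have "card Z = n"
    using deg le by simp
  then show ?thesis by (simp add: Z_def H_def)
qed

subsection \<open>Gauss--Hermite quadrature\<close>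

abbreviation herm_nodes :: "nat \<Rightarrow> real set" where
  "herm_nodes K \<equiv> {x. poly (hermite_poly (K + 1)) x = 0}"

lemma finite_herm_nodes: "finite (herm_nodes K)"
  by (rule poly_roots_finite[OF hermite_poly_nonzero])

lemma bij_betw_gh_node: "bij_betw (gh_node K) {0..K} (herm_nodes K)"
proof -
  define xs where "xs = sorted_list_of_set (herm_nodes K)"
  have len: "length xs = K + 1"
    unfolding xs_def length_sorted_list_of_set by (rule card_hermite_roots)
  have set: "set xs = herm_nodes K"
    unfolding xs_def by (rule set_sorted_list_of_set[OF finite_herm_nodes])
  have "bij_betw ((!) xs) {..<length xs} (set xs)"
    by (rule bij_betw_nth) (simp_all add: xs_def)
  moreover have "{..<length xs} = {0..K}"
    unfolding len by auto
  moreover have "(!) xs = gh_node K"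
    by (rule ext) (simp only: gh_node_def xs_def)
  ultimately show ?thesis
    by (simp only: set)
qed

lemma gh_node_root: "m \<le> K \<Longrightarrow> poly (hermite_poly (Suc K)) (gh_node K m) = 0"
  using bij_betw_apply[OF bij_betw_gh_node, of m K] by simp

lemma gh_node_eq_iff: "i \<le> K \<Longrightarrow> m \<le> K \<Longrightarrow> gh_node K i = gh_node K m \<longleftrightarrow> i = m"
  using inj_on_eq_iff[OF bij_betw_imp_inj_on[OF bij_betw_gh_node], of i K m] by simp

definition lagrange :: "nat \<Rightarrow> nat \<Rightarrow> real poly" where
  "lagrange K m =
     (\<Prod>i\<in>{0..K} - {m}. smult (1 / (gh_node K m - gh_node K i)) [:- gh_node K i, 1:])"

lemma poly_lagrange:
  "poly (lagrange K m) x = (\<Prod>i\<in>{0..K} - {m}. (x - gh_node K i) / (gh_node K m - gh_node K i))"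
  unfolding lagrange_def poly_prod by (intro prod.cong) (auto simp: diff_divide_distrib)

lemma gh_weight_eq: "gh_weight K m = herm_int (lagrange K m)"
  by (simp add: gh_weight_def herm_int_def poly_lagrange)

lemma degree_lagrange: "m \<le> K \<Longrightarrow> degree (lagrange K m) \<le> K"
proof -
  assume m: "m \<le> K"
  have "degree (lagrange K m) \<le> (\<Sum>i\<in>{0..K} - {m}. degree (smult (1 / (gh_node K m - gh_node K i)) [:- gh_node K i, 1:]))"
    unfolding lagrange_def
    by (rule order.trans[OF degree_prod_sum_le]) (simp_all add: o_def)
  also have "\<dots> \<le> (\<Sum>i\<in>{0..K} - {m}. 1)"
    by (intro sum_mono) (simp add: degree_smult_eq)
  also have "\<dots> = K"
    using m by simp
  finally show ?thesis .
qed

lemma poly_lagrange_node: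
  assumes "i \<le> K" "m \<le> K"
  shows "poly (lagrange K m) (gh_node K i) = (if i = m then 1 else 0)"
proof (cases "i = m")
  case True
  then show ?thesis
    using assms by (auto simp: poly_lagrange gh_node_eq_iff intro!: prod.neutral)
next
  case False
  then show ?thesis
    using assms by (auto simp: poly_lagrange intro!: prod_zero bexI[of _ i])
qed

definition gauss_sum :: "nat \<Rightarrow> real poly \<Rightarrow> real" where
  "gauss_sum K p = (\<Sum>m\<le>K. gh_weight K m * poly p (gh_node K m))"

lemma gauss_sum_add: "gauss_sum K (p + q) = gauss_sum K p + gauss_sum K q"
  by (simp add: gauss_sum_def algebra_simps sum.distrib)

lemma gauss_sum_smult: "gauss_sum K (smult c p) = c * gauss_sum K p"
  by (simp add: gauss_sum_def sum_distrib_left algebra_simps)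

lemma gauss_sum_hermite: "gauss_sum K (hermite_poly (Suc K) * q) = 0"
  unfolding gauss_sum_def poly_mult by (intro sum.neutral) (simp add: gh_node_root del: hermite_poly.simps)

lemma lagrange_interpolation:
  assumes "degree p \<le> K"
  shows "p = (\<Sum>m\<le>K. smult (poly p (gh_node K m)) (lagrange K m))"
proof (rule poly_eqI_degree[where A = "herm_nodes K"])
  have card: "card (herm_nodes K) = K + 1"
    by (rule card_hermite_roots)
  show "card (herm_nodes K) > degree p"
    using assms unfolding card by simp
  have "degree (\<Sum>m\<le>K. smult (poly p (gh_node K m)) (lagrange K m)) \<le> K"
    by (intro degree_sum_le) (auto intro: order.trans[OF degree_smult_le] degree_lagrange)
  then show "degree (\<Sum>m\<le>K. smult (poly p (gh_node K m)) (lagrange K m)) < card (herm_nodes K)"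
    unfolding card by simp
  fix x assume "x \<in> herm_nodes K"
  then have "x \<in> gh_node K ` {0..K}"
    by (simp only: bij_betw_imp_surj_on[OF bij_betw_gh_node])
  then obtain i where i: "i \<le> K" "x = gh_node K i"
    by auto
  have "poly (\<Sum>m\<le>K. smult (poly p (gh_node K m)) (lagrange K m)) x
      = (\<Sum>m\<le>K. poly p (gh_node K m) * poly (lagrange K m) x)"
    by (simp add: poly_sum)
  also have "\<dots> = (\<Sum>m\<le>K. if i = m then poly p x else 0)"
    using i by (intro sum.cong) (auto simp: poly_lagrange_node)
  also have "\<dots> = poly p x"
    using i(1) by simp
  finally show "poly p x = poly (\<Sum>m\<le>K. smult (poly p (gh_node K m)) (lagrange K m)) x"
    by (rule sym)
qed

lemma gauss_sum_exact_low:
  assumes "degree p \<le> K"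
  shows "gauss_sum K p = herm_int p"
proof -
  have "herm_int p = herm_int (\<Sum>m\<le>K. smult (poly p (gh_node K m)) (lagrange K m))"
    using lagrange_interpolation[OF assms] by simp
  then show ?thesis
    by (simp add: herm_int_sum herm_int_smult gauss_sum_def gh_weight_eq mult.commute)
qed

text \<open>Division by H_{K+1}: the multiple of H_{K+1} vanishes at the nodes, and its integral
  vanishes by orthogonality since the quotient has degree at most K. The remainder is handled by
  interpolation.\<close>

lemma gauss_sum_exact:
  assumes "degree p \<le> 2 * K + 1"
  shows "gauss_sum K p = herm_int p"
proof -
  define H where "H = hermite_poly (Suc K)"
  have H: "degree H = Suc K" "H \<noteq> 0"
    by (simp_all add: H_def degree_hermite_poly hermite_poly_nonzero del: hermite_poly.simps)
  have r: "degree (p mod H) \<le> K"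
    using degree_mod_less[OF H(2), of p] H(1) by auto
  have q: "degree (p div H) < Suc K"
  proof (cases "p div H = 0")
    case False
    have "Suc K + degree (p div H) = degree (H * (p div H))"
      using False H by (simp add: degree_mult_eq)
    also have "H * (p div H) = p - p mod H"
      by (metis minus_mod_eq_mult_div)
    also have "degree \<dots> \<le> 2 * K + 1"
      using r assms by (intro degree_diff_le) auto
    finally show ?thesis by simp
  qed simp
  have "gauss_sum K p = gauss_sum K (H * (p div H) + p mod H)"
    by simp
  also have "\<dots> = gauss_sum K (p mod H)"
    unfolding gauss_sum_add by (simp add: gauss_sum_hermite H_def del: hermite_poly.simps)
  also have "\<dots> = herm_int (p mod H)"
    by (rule gauss_sum_exact_low[OF r])
  also have "\<dots> = herm_int (H * (p div H) + p mod H)"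
    using herm_int_orthogonal[OF q] by (simp only: herm_int_add H_def)
  also have "\<dots> = herm_int p"
    by simp
  finally show ?thesis .
qed

text \<open>The square of a Lagrange polynomial has degree at most 2K, so the rule integrates it
  exactly, and its quadrature value is the single weight.\<close>

lemma gh_weight_nonneg:
  assumes "m \<le> K"
  shows "gh_weight K m \<ge> 0"
proof -
  have "gauss_sum K (lagrange K m * lagrange K m) = (\<Sum>i\<le>K. if i = m then gh_weight K m else 0)"
    unfolding gauss_sum_def using assms by (intro sum.cong) (auto simp: poly_lagrange_node)
  then have "gh_weight K m = gauss_sum K (lagrange K m * lagrange K m)"
    using assms by simp
  also have "\<dots> = herm_int (lagrange K m * lagrange K m)"
  proof (rule gauss_sum_exact)
    show "degree (lagrange K m * lagrange K m) \<le> 2 * K + 1"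
      using degree_mult_le[of "lagrange K m" "lagrange K m"] degree_lagrange[OF assms] by simp
  qed
  also have "\<dots> \<ge> 0"
    unfolding herm_int_def by (rule integral_nonneg_AE) simp
  finally show ?thesis .
qed

lemma gh_node_bound: "m \<le> K \<Longrightarrow> (gh_node K m)\<^sup>2 \<le> 2 * real K"
  by (rule hermite_poly_root_bound[OF gh_node_root])

definition hermite_normed :: "nat \<Rightarrow> real poly" where
  "hermite_normed k = smult (pi powr (- 1 / 4) / sqrt (2 ^ k * fact k)) (hermite_poly k)"

lemma hermite_fun1_eq: "hermite_fun1 k x = poly (hermite_normed k) x * exp (- x\<^sup>2 / 2)"
  by (simp add: hermite_fun1_def hermite_normed_def)

lemma hermite_fun1_mult:
  "hermite_fun1 j x * hermite_fun1 k x = poly (hermite_normed j * hermite_normed k) x * exp (- x\<^sup>2)"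
  by (simp add: hermite_fun1_eq flip: exp_add)

lemma degree_hermite_normed: "degree (hermite_normed k) \<le> k"
  unfolding hermite_normed_def using degree_hermite_poly[of k] degree_smult_le[of _ "hermite_poly k"] by metis

lemma hermite_normed_const_square:
  "(pi powr (- 1 / 4) / sqrt (2 ^ k * fact k))\<^sup>2 = 1 / (sqrt pi * 2 ^ k * fact k)"
proof -
  have "(pi powr (- 1 / 4))\<^sup>2 = pi powr (- 1 / 4 + - 1 / 4)"
    by (simp only: power2_eq_square powr_add)
  also have "- 1 / 4 + - 1 / 4 = - (1 / 2 :: real)"
    by simp
  also have "pi powr - (1 / 2) = 1 / sqrt pi"
    by (simp only: powr_minus_divide powr_half_sqrt pi_ge_zero)
  finally show ?thesis
    by (simp add: power_divide)
qed

lemma herm_int_hermite_normed: "herm_int (hermite_normed k * hermite_normed k) = 1"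
proof -
  have "herm_int (hermite_normed k * hermite_normed k) =
     (pi powr (- 1 / 4) / sqrt (2 ^ k * fact k))\<^sup>2 * herm_int (hermite_poly k * hermite_poly k)"
    by (simp add: hermite_normed_def herm_int_smult power2_eq_square)
  then show ?thesis
    unfolding hermite_normed_const_square herm_int_hermite_square by simp
qed

text \<open>|pq| <= (p^2 + q^2)/2 at each node; the quadrature values of both squares are exact and
  equal to 1.\<close>

lemma gauss_sum_bound:
  assumes "j \<le> K" "k \<le> K" and t: "\<And>m. m \<le> K \<Longrightarrow> \<bar>poly t (gh_node K m)\<bar> \<le> B"
  shows "\<bar>gauss_sum K (hermite_normed j * hermite_normed k * t)\<bar> \<le> B"
proof -
  define p q where "p m = poly (hermite_normed j) (gh_node K m)"
    and "q m = poly (hermite_normed k) (gh_node K m)" for m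
  have one: "gauss_sum K (hermite_normed i * hermite_normed i) = 1" if "i \<le> K" for i
    using that degree_mult_le[of "hermite_normed i" "hermite_normed i"] degree_hermite_normed[of i]
    by (subst gauss_sum_exact) (auto simp: herm_int_hermite_normed)
  have "\<bar>gauss_sum K (hermite_normed j * hermite_normed k * t)\<bar> \<le>
      (\<Sum>m\<le>K. \<bar>gh_weight K m * (p m * q m * poly t (gh_node K m))\<bar>)"
    unfolding gauss_sum_def p_def q_def poly_mult by (rule sum_abs)
  also have "\<dots> \<le> (\<Sum>m\<le>K. gh_weight K m * ((p m * p m + q m * q m) / 2 * B))"
  proof (rule sum_mono)
    fix m assume m: "m \<in> {..K}"
    have "(\<bar>p m\<bar> - \<bar>q m\<bar>)\<^sup>2 \<ge> 0" by simp
    then have "\<bar>p m * q m\<bar> \<le> (p m * p m + q m * q m) / 2"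
      by (simp add: power2_eq_square algebra_simps abs_mult)
    then have "\<bar>p m * q m * poly t (gh_node K m)\<bar> \<le> (p m * p m + q m * q m) / 2 * B"
      unfolding abs_mult[of "p m * q m"] using t m by (intro mult_mono) auto
    then have "gh_weight K m * \<bar>p m * q m * poly t (gh_node K m)\<bar>
        \<le> gh_weight K m * ((p m * p m + q m * q m) / 2 * B)"
      using m by (intro mult_left_mono gh_weight_nonneg) simp_all
    then show "\<bar>gh_weight K m * (p m * q m * poly t (gh_node K m))\<bar>
        \<le> gh_weight K m * ((p m * p m + q m * q m) / 2 * B)"
      unfolding abs_mult[of "gh_weight K m"] using gh_weight_nonneg[of m K] m by simp
  qed
  also have "\<dots> = (\<Sum>m\<le>K. (gh_weight K m * (p m * p m) + gh_weight K m * (q m * q m)) * (B / 2))"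
    by (intro sum.cong refl) (simp add: field_simps)
  also have "\<dots> = (gauss_sum K (hermite_normed j * hermite_normed j)
      + gauss_sum K (hermite_normed k * hermite_normed k)) * (B / 2)"
    unfolding gauss_sum_def poly_mult p_def q_def by (simp only: sum_distrib_right[symmetric] sum.distrib)
  also have "\<dots> = B"
    using one assms by simp
  finally show ?thesis .
qed

subsection \<open>Chebyshev polynomials and univariate matrix entries\<close>

lemma poly_chebyshev_cos: "poly (chebyshev_poly n) (cos \<theta>) = cos (real n * \<theta>)"
proof (induction n rule: chebyshev_poly.induct)
  case (3 n)
  have "cos (real (Suc (Suc n)) * \<theta>) = cos (real (Suc n) * \<theta> + \<theta>)"
    by (simp add: algebra_simps)
  moreover have "cos (real n * \<theta>) = cos (real (Suc n) * \<theta> - \<theta>)"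
    by (simp add: algebra_simps)
  ultimately show ?case
    using 3 by (simp add: cos_add cos_diff)
qed simp_all

lemma poly_chebyshev_joukowski:
  "z \<noteq> 0 \<Longrightarrow> poly (chebyshev_poly n) ((z + 1 / z) / 2) = (z ^ n + 1 / z ^ n) / 2"
proof (induction n rule: chebyshev_poly.induct)
  case (3 n)
  have "poly (chebyshev_poly (Suc (Suc n))) ((z + 1 / z) / 2) =
      (z + 1 / z) * ((z ^ Suc n + 1 / z ^ Suc n) / 2) - (z ^ n + 1 / z ^ n) / 2"
    unfolding chebyshev_poly.simps(3) poly_diff poly_mult 3(1)[OF 3(3)] 3(2)[OF 3(3)] by simp
  also have "\<dots> = (z ^ Suc (Suc n) + 1 / z ^ Suc (Suc n)) / 2"
    using 3(3) by (simp add: field_simps)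
  finally show ?case .
qed simp_all

lemma poly_chebyshev_minus: "poly (chebyshev_poly n) (- x) = (- 1) ^ n * poly (chebyshev_poly n) x"
  by (induction n rule: chebyshev_poly.induct) (simp_all add: algebra_simps)

lemma degree_chebyshev_le: "degree (chebyshev_poly n) \<le> n"
proof (induction n rule: chebyshev_poly.induct)
  case (3 n)
  have "degree ([:0, 2:] * chebyshev_poly (Suc n)) \<le> Suc (Suc n)"
    using 3 by (intro order.trans[OF degree_mult_le]) auto
  then show ?case
    unfolding chebyshev_poly.simps(3) using 3 by (intro degree_diff_le) auto
qed simp_all

lemma chebyshev_bound: "\<bar>x\<bar> \<le> 1 \<Longrightarrow> \<bar>poly (chebyshev_poly n) x\<bar> \<le> 1"
  using poly_chebyshev_cos[of n "arccos x"] by simp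

text \<open>Outside [-1, 1] write |x| = (z + 1/z)/2 with z >= 1, so that T_n(|x|) is the mean of z^n
  and z^(-n). The bound is stated through the same parameter \<open>y\<close> because z + 1/z is
  increasing on [1, oo), whence z <= y.\<close>

lemma chebyshev_growth:
  assumes y: "y \<ge> 1" and x: "\<bar>x\<bar> \<le> (y + 1 / y) / 2"
  shows "\<bar>poly (chebyshev_poly n) x\<bar> \<le> y ^ n"
proof (cases "\<bar>x\<bar> \<le> 1")
  case True
  then show ?thesis
    using chebyshev_bound[of x n] one_le_power[OF y, of n] by linarith
next
  case False
  define s where "s = sqrt (x\<^sup>2 - 1)"
  define z where "z = \<bar>x\<bar> + s"
  have "1 \<le> \<bar>x\<bar>\<^sup>2"
    using False by (intro one_le_power) auto
  then have s: "s \<ge> 0" "s\<^sup>2 = x\<^sup>2 - 1"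
    by (simp_all add: s_def)
  have z: "z \<ge> 1" using s False by (simp add: z_def)
  have "z * (\<bar>x\<bar> - s) = 1"
    using s(2) by (simp add: z_def algebra_simps power2_eq_square)
  then have "1 / z = \<bar>x\<bar> - s"
    using z by (simp add: field_simps)
  then have x_eq: "\<bar>x\<bar> = (z + 1 / z) / 2"
    by (simp add: z_def)
  have zy: "z \<le> y"
  proof (rule ccontr)
    assume "\<not> z \<le> y"
    then have zy: "z > y" by simp
    moreover have "z * y \<ge> z * 1"
      using y z by (intro mult_left_mono) auto
    ultimately have "z * y > 1"
      using y by linarith
    then have "(z - y) * (1 - 1 / (z * y)) > 0"
      using zy by (intro mult_pos_pos) simp_all
    \<comment> \<open>This factorisation is the monotonicity of z + 1/z; the second factor is
      positive since z * y > 1.\<close>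
    also have "(z - y) * (1 - 1 / (z * y)) = z + 1 / z - (y + 1 / y)"
      using y z by (simp add: algebra_simps divide_simps)
    finally have "z + 1 / z > y + 1 / y"
      by simp
    then show False using x x_eq by simp
  qed
  have "1 / z ^ n \<le> 1"
    using one_le_power[OF z, of n] by simp
  then have zn: "1 / z ^ n \<le> z ^ n"
    using one_le_power[OF z, of n] by (rule order.trans)
  have mean: "(a + b) / 2 \<le> a" if "b \<le> a" for a b :: real
    using that by simp
  have "\<bar>poly (chebyshev_poly n) x\<bar> = \<bar>poly (chebyshev_poly n) \<bar>x\<bar>\<bar>"
    by (cases "x \<ge> 0") (simp_all add: poly_chebyshev_minus abs_mult)
  also have "\<dots> = (z ^ n + 1 / z ^ n) / 2"
    unfolding x_eq using z by (subst poly_chebyshev_joukowski) (auto intro!: add_nonneg_nonneg)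
  also have "\<dots> \<le> z ^ n"
    by (rule mean[OF zn])
  also have "\<dots> \<le> y ^ n"
    using z zy by (intro power_mono) auto
  finally show ?thesis .
qed

section \<open>Univariate matrix entries, exact and by quadrature\<close>

definition scaled_chebyshev :: "real \<Rightarrow> nat \<Rightarrow> real poly" where
  "scaled_chebyshev L r = pcompose (chebyshev_poly r) [:0, 1 / L:]"

lemma poly_scaled_chebyshev: "poly (scaled_chebyshev L r) x = poly (chebyshev_poly r) (x / L)"
  by (simp add: scaled_chebyshev_def poly_pcompose)

lemma degree_scaled_chebyshev_le: "degree (scaled_chebyshev L r) \<le> r"
proof -
  have "degree (scaled_chebyshev L r) \<le> degree (chebyshev_poly r) * degree [:0, 1 / L:]"
    unfolding scaled_chebyshev_def by (rule degree_pcompose_le)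
  also have "\<dots> \<le> r * 1"
    using degree_chebyshev_le by (intro mult_mono) auto
  finally show ?thesis by simp
qed

definition exact_entry :: "real \<Rightarrow> nat \<Rightarrow> nat \<Rightarrow> nat \<Rightarrow> real" where
  "exact_entry L r j k = herm_int (hermite_normed j * hermite_normed k * scaled_chebyshev L r)"

definition quad_entry :: "nat \<Rightarrow> real \<Rightarrow> nat \<Rightarrow> nat \<Rightarrow> nat \<Rightarrow> real" where
  "quad_entry K L r j k = gauss_sum K (hermite_normed j * hermite_normed k * scaled_chebyshev L r)"

lemma quad_entry_exact:
  assumes "j + k + r \<le> 2 * K + 1"
  shows "quad_entry K L r j k = exact_entry L r j k"
proof -
  have "degree (hermite_normed j * hermite_normed k * scaled_chebyshev L r) \<le> j + k + r"
    by (intro order.trans[OF degree_mult_le] add_mono degree_hermite_normed degree_scaled_chebyshev_le)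
  then show ?thesis
    unfolding quad_entry_def exact_entry_def using assms by (intro gauss_sum_exact) simp
qed

text \<open>The nodes satisfy |x| <= sqrt(2K), and \<open>y\<close> measures how far they may leave
  [-L, L]. The choice y = 1 means that they stay inside and gives the bound 1.\<close>

lemma quad_entry_bound:
  assumes "j \<le> K" "k \<le> K" "y \<ge> 1" "L > 0" "sqrt (2 * real K) \<le> L * ((y + 1 / y) / 2)"
  shows "\<bar>quad_entry K L r j k\<bar> \<le> y ^ r"
  unfolding quad_entry_def
proof (rule gauss_sum_bound)
  fix m assume "m \<le> K"
  then have "\<bar>gh_node K m\<bar> \<le> sqrt (2 * real K)"
    by (intro real_le_rsqrt) (simp add: gh_node_bound)
  also note assms(5)
  finally show "\<bar>poly (scaled_chebyshev L r) (gh_node K m)\<bar> \<le> y ^ r"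
    unfolding poly_scaled_chebyshev using assms
    by (intro chebyshev_growth) (auto simp: abs_divide divide_le_eq mult.commute)
qed (use assms in auto)

text \<open>The integrand has polynomial degree at most 2K + r, within the exactness range 2(K + r)
  + 1 of the rule for K + r.\<close>

lemma exact_entry_bound:
  assumes "j \<le> K" "k \<le> K" "y \<ge> 1" "L > 0" "sqrt (2 * real (K + r)) \<le> L * ((y + 1 / y) / 2)"
  shows "\<bar>exact_entry L r j k\<bar> \<le> y ^ r"
  using quad_entry_bound[of j "K + r" k y L r] quad_entry_exact[of j k r "K + r" L] assms by simp

text \<open>Expand the square of 2x H_K = H_{K+1} + H_K'. The mixed terms vanish under both
  functionals, and the square of H_K' is integrated exactly. On the square of H_{K+1} the rule gives
  0 and the integral gives its norm, so this norm is the whole error.\<close>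

lemma square_entry_error:
  "exact_entry L 2 K K - quad_entry K L 2 K K = (real K + 1) / L\<^sup>2"
proof -
  define H H1 H' where "H = hermite_poly K" and "H1 = hermite_poly (Suc K)"
    and "H' = pderiv (hermite_poly K)"
  define c where "c = pi powr (- 1 / 4) / sqrt (2 ^ K * fact K)"
  define err where "err p = herm_int p - gauss_sum K p" for p
  have err_add: "err (p + q) = err p + err q" for p q
    by (simp add: err_def herm_int_add gauss_sum_add)
  have err_smult: "err (smult a p) = a * err p" for a p
    by (simp add: err_def herm_int_smult gauss_sum_smult algebra_simps)
  have err_exact: "err p = 0" if "degree p \<le> 2 * K + 1" for p
    using gauss_sum_exact[OF that] by (simp add: err_def)
  have degH: "degree H = K" "degree H' \<le> K"
    by (simp_all add: H_def H'_def degree_hermite_poly degree_pderiv)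
  have xH: "[:0, 2:] * H = H1 + H'"
    by (simp add: H_def H1_def H'_def hermite_poly_Suc del: hermite_poly.simps)
  have "degree H' < Suc K" using degH by simp
  then have "herm_int (H1 * H') = 0"
    unfolding H1_def by (rule herm_int_orthogonal)
  then have errHH': "err (H1 * H') = 0"
    by (simp add: err_def H1_def gauss_sum_hermite del: hermite_poly.simps)
  have errHH: "err (H1 * H1) = sqrt pi * 2 ^ Suc K * fact (Suc K)"
    unfolding err_def H1_def gauss_sum_hermite herm_int_hermite_square by simp
  have errH'H': "err (H' * H') = 0"
    using degH degree_mult_le[of H' H'] by (intro err_exact) simp
  have "err (([:0, 2:] * H) * ([:0, 2:] * H)) = err (H1 * H1 + (H1 * H' + H1 * H') + H' * H')"
    unfolding xH by (simp add: algebra_simps)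
  also have "\<dots> = sqrt pi * 2 ^ Suc K * fact (Suc K)"
    unfolding err_add errHH errHH' errH'H' by simp
  finally have errx: "err (([:0, 2:] * H) * ([:0, 2:] * H)) = sqrt pi * 2 ^ Suc K * fact (Suc K)" .
  \<comment> \<open>T_2(x/L) = 2x^2/L^2 - 1, written with (2x)^2 so that each factor 2x can be
    attached to one H_K.\<close>
  have "scaled_chebyshev L 2 = smult (1 / (2 * L\<^sup>2)) ([:0, 2:] * [:0, 2:]) + [:- 1:]"
    unfolding poly_eq_poly_eq_iff[symmetric]
    by (rule ext) (simp add: poly_scaled_chebyshev numeral_2_eq_2 power_divide)
  moreover have "hermite_normed K = smult c H"
    by (simp add: hermite_normed_def H_def c_def)
  ultimately have "hermite_normed K * hermite_normed K * scaled_chebyshev L 2 =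
      smult (c\<^sup>2 / (2 * L\<^sup>2)) (([:0, 2:] * H) * ([:0, 2:] * H)) + smult (- (c\<^sup>2)) (H * H)"
    unfolding poly_eq_poly_eq_iff[symmetric]
    by (intro ext) (simp add: algebra_simps power2_eq_square)
  then have "err (hermite_normed K * hermite_normed K * scaled_chebyshev L 2) =
      c\<^sup>2 / (2 * L\<^sup>2) * err (([:0, 2:] * H) * ([:0, 2:] * H)) - c\<^sup>2 * err (H * H)"
    by (simp only: err_add err_smult)
  also have "err (H * H) = 0"
    using degH degree_mult_le[of H H] by (intro err_exact) simp
  also have "c\<^sup>2 / (2 * L\<^sup>2) * err (([:0, 2:] * H) * ([:0, 2:] * H)) - c\<^sup>2 * 0 = (real K + 1) / L\<^sup>2"
  proof -
    define a where "a = sqrt pi * 2 ^ K * fact K"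
    have a: "a \<noteq> 0" "sqrt pi * 2 ^ Suc K * fact (Suc K) = 2 * (real K + 1) * a"
      by (simp_all add: a_def algebra_simps)
    show ?thesis
      unfolding errx c_def hermite_normed_const_square a(2) a_def[symmetric] using a(1)
      by (cases "L = 0") (simp_all add: field_simps)
  qed
  finally show ?thesis
    by (simp add: exact_entry_def quad_entry_def err_def)
qed

subsection \<open>The weighted univariate quadrature error\<close>

definition cheb_const :: "nat \<Rightarrow> real" where
  "cheb_const r = 1 / 4 * (real r)\<^sup>2 * (real r - 1) * real (r choose nat \<lfloor>real r / 2 - 1\<rfloor>)"

lemma nat_floor_half_minus_one: "nat \<lfloor>real r / 2 - 1\<rfloor> = r div 2 - 1"
proof -
  have "\<lfloor>real r / 2 - 1\<rfloor> = int (r div 2) - 1"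
    using floor_divide_of_nat_eq[of r 2, where ?'a = real] by simp
  then show ?thesis by simp
qed

text \<open>When r grows by one, the lower index either stays or also grows by one; Pascal's rule
  covers both cases.\<close>

lemma binomial_half_mono: "(r choose (r div 2 - 1)) \<le> (Suc r choose (Suc r div 2 - 1))"
proof (cases "Suc r div 2 - 1 = r div 2 - 1")
  case True
  then show ?thesis
    by (cases "r div 2 - 1") auto
next
  case False
  then have "Suc r div 2 - 1 = Suc (r div 2 - 1)" by linarith
  then show ?thesis by (simp only: binomial_Suc_Suc le_add1)
qed

lemma cheb_const_eq: "cheb_const r = 1 / 4 * (real r)\<^sup>2 * (real r - 1) * real (r choose (r div 2 - 1))"
  by (simp only: cheb_const_def nat_floor_half_minus_one)

lemma cheb_const_nonneg: "cheb_const r \<ge> 0"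
  by (cases r) (simp_all add: cheb_const_eq)

text \<open>Needed because the critical direction l contributes the constant for r_l, whereas the
  final constant is formed with the largest r_l.\<close>

lemma cheb_const_mono: "r \<le> s \<Longrightarrow> cheb_const r \<le> cheb_const s"
proof (induction s rule: dec_induct)
  case (step s)
  have "cheb_const s \<le> cheb_const (Suc s)"
  proof (cases s)
    case 0
    then show ?thesis by (simp add: cheb_const_eq)
  next
    case (Suc n)
    have "(real s)\<^sup>2 * (real s - 1) \<le> (real (Suc s))\<^sup>2 * (real (Suc s) - 1)"
      using Suc by (intro mult_mono power_mono) auto
    then have "(real s)\<^sup>2 * (real s - 1) * real (s choose (s div 2 - 1))
        \<le> (real (Suc s))\<^sup>2 * (real (Suc s) - 1) * real (Suc s choose (Suc s div 2 - 1))"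
      using Suc binomial_half_mono[of s] by (intro mult_mono) (auto simp del: binomial_Suc_Suc)
    then show ?thesis
      unfolding cheb_const_eq by simp
  qed
  with step show ?case by simp
qed simp

text \<open>Pascal's rule applied twice gives C(n + 2, h + 1) >= 2 C(n, h). The upper indices 2h + 2
  and 2h + 3 are the two values of r with r div 2 - 1 = h.\<close>

lemma binomial_half_lower: "2 ^ h \<le> (2 * h + 2) choose h \<and> 2 ^ h \<le> (2 * h + 3) choose h"
proof (induction h)
  case (Suc h)
  have *: "2 * (n choose h) \<le> Suc (Suc n) choose Suc h" for n
    by (cases h) simp_all
  have "2 * Suc h + 2 = Suc (Suc (2 * h + 2))" "2 * Suc h + 3 = Suc (Suc (2 * h + 3))"
    by simp_all
  then show ?case
    using Suc *[of "2 * h + 2"] *[of "2 * h + 3"] by (simp del: binomial_Suc_Suc)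
qed simp

text \<open>The base \<open>103 / 100\<close> is small enough for the exponential growth of \<open>T\<^sub>r\<close> slightly
  outside \<open>[-1, 1]\<close> to be absorbed by the binomial coefficient.\<close>

lemma growth_le_cheb_const:
  assumes "r \<ge> 3"
  shows "real (r - 1) * ((1 + (103 / 100) ^ r) * (15 / 14)) \<le> cheb_const r"
proof -
  define h where "h = r div 2 - 1"
  have r: "r = 2 * h + 2 \<or> r = 2 * h + 3"
    using assms by (auto simp: h_def)
  then have C: "2 ^ h \<le> real (r choose h)"
    using binomial_half_lower[of h] by (metis of_nat_le_iff of_nat_numeral of_nat_power)
  have "(103 / 100 :: real) ^ r \<le> (103 / 100) ^ (2 * h + 3)"
    using r by (intro power_increasing) auto
  also have "\<dots> = (103 / 100) ^ 3 * ((103 / 100)\<^sup>2) ^ h"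
    by (simp add: power_add power_mult)
  \<comment> \<open>1.03^3 = 1.092727 is below 11/10 and 1.03^2 is far below 2.\<close>
  also have "\<dots> \<le> 11 / 10 * 2 ^ h"
    by (intro mult_mono power_mono) (simp_all add: power2_eq_square power3_eq_cube)
  finally have g: "(103 / 100 :: real) ^ r \<le> 11 / 10 * 2 ^ h" .
  \<comment> \<open>With a >= 1 the left side is at most 2.1 * (15/14) * a, which is exactly 9/4 *
    a; and 9/4 is r^2/4 at r = 3.\<close>
  have arith: "(1 + b) * (15 / 14) \<le> 9 / 4 * a" if "1 \<le> a" "b \<le> 11 / 10 * a" for a b :: real
    using that by (simp add: field_simps)
  have "1 \<le> (2 :: real) ^ h" by simp
  then have "(1 + (103 / 100) ^ r) * (15 / 14) \<le> 9 / 4 * (2 :: real) ^ h"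
    using g by (rule arith)
  also have "\<dots> \<le> 9 / 4 * real (r choose h)"
    using C by simp
  also have "\<dots> \<le> 1 / 4 * (real r)\<^sup>2 * real (r choose h)"
    using assms power_mono[of 3 "real r" 2] by (intro mult_right_mono) auto
  finally have "(1 + (103 / 100) ^ r) * (15 / 14) \<le> 1 / 4 * (real r)\<^sup>2 * real (r choose h)" .
  then have "real (r - 1) * ((1 + (103 / 100) ^ r) * (15 / 14)) \<le>
      real (r - 1) * (1 / 4 * (real r)\<^sup>2 * real (r choose h))"
    by (intro mult_left_mono) auto
  also have "\<dots> = cheb_const r"
    using assms by (simp add: cheb_const_eq h_def of_nat_diff)
  finally show ?thesis .
qed

text \<open>Bernoulli's inequality: (1 - r/K)^beta >= 1 - beta * r/K >= 14/15, the last step because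
  K >= 15 * beta * r.\<close>

lemma weight_near_top:
  fixes \<beta> K k r :: nat
  assumes "real K \<ge> (1300 + 15 * real \<beta>) * real r" "r \<ge> 1" "k + r \<ge> K"
  shows "1 / real k ^ \<beta> \<le> 15 / 14 * (1 / real K ^ \<beta>)"
proof -
  have K: "real K \<ge> 1300 * real r" "15 * real \<beta> * real r \<le> real K"
    using assms(1) mult_nonneg_nonneg[of "15 * real \<beta>" "real r"] mult_nonneg_nonneg[of 1300 "real r"]
    unfolding distrib_right by linarith+
  then have K0: "real K > 0" using assms(2) by linarith
  have k: "real k \<ge> real K - real r" "real k > 0"
    using assms(2,3) K by linarith+
  define x where "x = real r / real K"
  have x: "0 \<le> x" "x \<le> 1" "real \<beta> * x \<le> 1 / 15"
    using K K0 by (simp_all add: x_def field_simps)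
  have "14 / 15 \<le> 1 + real \<beta> * (- x)"
    using x by simp
  also have "\<dots> \<le> (1 + (- x)) ^ \<beta>"
    using x by (intro Bernoulli_inequality) simp
  also have "\<dots> \<le> (real k / real K) ^ \<beta>"
  proof (rule power_mono)
    have "1 + (- x) = (real K - real r) / real K"
      using K0 by (simp add: x_def diff_divide_distrib)
    also have "\<dots> \<le> real k / real K"
      using k K0 by (intro divide_right_mono) simp_all
    finally show "1 + (- x) \<le> real k / real K" .
  qed (use x in simp)
  finally have "14 / 15 * real K ^ \<beta> \<le> real k ^ \<beta>"
    using K0 by (simp add: power_divide field_simps)
  then show ?thesis
    using k K0 by (simp add: field_simps)
qed

text \<open>Origin of 1300: the mean of 1.03 and 1/1.03 exceeds 1.0004, and 1.0004^2 - 1 > 0.0008 >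
  1/1300, so r <= K/1300 keeps K + r below 1.0004^2 * (K + 1).\<close>

lemma node_range_condition:
  assumes "real K \<ge> 1300 * real r" "L \<ge> sqrt (2 * (real K + 1)) + 1"
  shows "sqrt (2 * real (K + r)) \<le> L * ((103 / 100 + 1 / (103 / 100)) / 2)"
proof -
  have "sqrt (2 * real (K + r)) \<le> sqrt ((10004 / 10000)\<^sup>2 * (2 * (real K + 1)))"
    using assms(1) by (intro real_sqrt_le_mono) (simp add: power2_eq_square)
  also have "\<dots> = 10004 / 10000 * sqrt (2 * (real K + 1))"
    by (simp add: real_sqrt_mult)
  also have "\<dots> \<le> ((103 / 100 + 1 / (103 / 100)) / 2) * L"
    using assms(2) by (intro mult_mono) (simp_all add: real_sqrt_ge_zero)
  finally show ?thesis by (simp only: mult.commute)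
qed

lemma quad_entry_le_one:
  assumes "j \<le> K" "k \<le> K" "L \<ge> sqrt (2 * (real K + 1)) + 1"
  shows "\<bar>quad_entry K L r j k\<bar> \<le> 1"
proof -
  have "sqrt (2 * real K) \<le> sqrt (2 * (real K + 1))" by simp
  moreover have "0 \<le> sqrt (2 * real K)" by simp
  ultimately have "L > 0" "sqrt (2 * real K) \<le> L" using assms(3) by linarith+
  then show ?thesis
    using quad_entry_bound[of j K k 1 L r] assms by simp
qed

lemma weighted_entry_error_bound:
  fixes \<beta> K r j :: nat
  assumes K: "real K \<ge> (1300 + 15 * real \<beta>) * real r" and L: "L \<ge> sqrt (2 * (real K + 1)) + 1"
    and j: "j \<le> K"
  shows "(\<Sum>k\<le>K. \<bar>exact_entry L r j k - quad_entry K L r j k\<bar> / real (max k 1) ^ \<beta>)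
    \<le> cheb_const r / real K ^ \<beta>"
proof -
  define D where "D k = \<bar>exact_entry L r j k - quad_entry K L r j k\<bar>" for k
  have D0: "D k = 0" if "j + k + r \<le> 2 * K + 1" for k
    using quad_entry_exact[OF that] by (simp add: D_def)
  have sq: "sqrt (2 * (real K + 1)) \<ge> 0" by simp
  have L0: "L > 0" using L sq by linarith
  have K1300: "real K \<ge> 1300 * real r"
    using K mult_nonneg_nonneg[of "15 * real \<beta>" "real r"] unfolding distrib_right by linarith
  consider "r \<le> 1" | "r = 2" | "r \<ge> 3" by linarith
  then have "(\<Sum>k\<le>K. D k / real (max k 1) ^ \<beta>) \<le> cheb_const r / real K ^ \<beta>"
  proof cases
    case 1
    then have "D k = 0" if "k \<le> K" for k
      using that j by (intro D0) linarith
    then show ?thesis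
      using cheb_const_nonneg[of r] by simp
  next
    case 2
    have K1: "K \<ge> 1" using K1300 2 by simp
    have "(\<Sum>k\<le>K. D k / real (max k 1) ^ \<beta>) = (\<Sum>k\<in>{K}. D k / real (max k 1) ^ \<beta>)"
      using j 2 by (intro sum.mono_neutral_right) (auto intro!: D0)
    also have "\<dots> = D K / real K ^ \<beta>"
      using K1 by simp
    \<comment> \<open>The constant equals 1 at r = 2, so the general estimate 1 + 1.03^2 would be
      too large. For j = K the exact error (K + 1)/L^2 is at most 1, since L^2 >= 2(K + 1).\<close>
    also have "D K \<le> 1"
    proof (cases "j = K")
      case True
      have "(sqrt (2 * (real K + 1)))\<^sup>2 \<le> L\<^sup>2"
        using L sq by (intro power_mono) linarith+
      then have "real K + 1 \<le> L\<^sup>2" by simp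
      then show ?thesis
        unfolding D_def True 2 square_entry_error using L0 by simp
    next
      case False
      then have "D K = 0" using j 2 by (intro D0) simp
      then show ?thesis by simp
    qed
    then have "D K / real K ^ \<beta> \<le> cheb_const r / real K ^ \<beta>"
      using 2 by (intro divide_right_mono) (simp_all add: cheb_const_eq)
    finally show ?thesis .
  next
    case 3
    \<comment> \<open>As j <= K, an inexact entry needs k >= K + 2 - r. Because K >= 1300 r this
      subtraction does not truncate and k is positive, so \<open>max k 1\<close> is k on
      \<open>A\<close>.\<close>
    define A where "A = {k. K + 2 \<le> k + r \<and> k \<le> K}"
    have A: "A = {K + 2 - r..K}" "finite A"
      using K1300 3 by (auto simp: A_def)
    have cardA: "card A = r - 1"
      using K1300 3 unfolding A by simp
    have "(\<Sum>k\<le>K. D k / real (max k 1) ^ \<beta>) = (\<Sum>k\<in>A. D k / real (max k 1) ^ \<beta>)"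
      using j by (intro sum.mono_neutral_right) (auto simp: A_def intro!: D0)
    also have "\<dots> \<le> (\<Sum>k\<in>A. (1 + (103 / 100) ^ r) * (15 / 14 * (1 / real K ^ \<beta>)))"
    proof (rule sum_mono)
      fix k assume "k \<in> A"
      then have k: "k \<le> K" "k + r \<ge> K + 2" by (auto simp: A_def)
      then have max: "max k 1 = k"
        using K1300 3 by (auto simp: max_def)
      have "\<bar>exact_entry L r j k\<bar> \<le> (103 / 100) ^ r"
        using node_range_condition[OF K1300 L] j k L0 by (intro exact_entry_bound) auto
      moreover have "\<bar>quad_entry K L r j k\<bar> \<le> 1"
        using j k L by (intro quad_entry_le_one)
      ultimately have "D k \<le> 1 + (103 / 100) ^ r"
        unfolding D_def by linarith
      moreover have "1 / real k ^ \<beta> \<le> 15 / 14 * (1 / real K ^ \<beta>)"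
        using K k 3 by (intro weight_near_top[where r = r]) auto
      ultimately have "D k * (1 / real k ^ \<beta>) \<le> (1 + (103 / 100) ^ r) * (15 / 14 * (1 / real K ^ \<beta>))"
        by (intro mult_mono) (auto simp: add_nonneg_nonneg)
      then show "D k / real (max k 1) ^ \<beta> \<le> (1 + (103 / 100) ^ r) * (15 / 14 * (1 / real K ^ \<beta>))"
        by (simp only: max) simp
    qed
    also have "\<dots> = real (r - 1) * ((1 + (103 / 100) ^ r) * (15 / 14)) / real K ^ \<beta>"
      by (simp add: cardA)
    also have "\<dots> \<le> cheb_const r / real K ^ \<beta>"
      by (intro divide_right_mono growth_le_cheb_const 3) simp
    finally show ?thesis .
  qed
  then show ?thesis by (simp add: D_def)
qed

subsection \<open>Tensor product structure\<close>

text \<open>Lebesgue measure on R^N is the image of a product measure indexed by basis vectors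
  rather than coordinates. The auxiliary map \<open>ix\<close> recovers the coordinate of a basis
  vector, after which Fubini for finite products applies.\<close>

lemma lborel_integral_prod:
  fixes f :: "'n::finite \<Rightarrow> real \<Rightarrow> real"
  assumes int: "\<And>l. integrable lborel (f l)"
  shows "integral\<^sup>L lborel (\<lambda>x :: real ^ 'n. \<Prod>l\<in>UNIV. f l (x $ l)) = (\<Prod>l\<in>UNIV. integral\<^sup>L lborel (f l))"
    and "integrable lborel (\<lambda>x :: real ^ 'n. \<Prod>l\<in>UNIV. f l (x $ l))"
proof -
  have [measurable]: "f l \<in> borel_measurable borel" for l
    using borel_measurable_integrable[OF int[of l]] by simp
  define ix where "ix b = (THE l. b = axis l (1::real))" for b :: "real ^ 'n"
  have ix: "ix (axis l 1) = l" for l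
    unfolding ix_def by (rule the_equality) (auto simp: axis_eq_axis)
  have B: "(Basis :: (real ^ 'n) set) = (\<lambda>l. axis l 1) ` UNIV"
    by (auto simp: Basis_vec_def)
  have inj: "inj (\<lambda>l. axis l (1::real) :: real ^ 'n)"
    by (auto simp: inj_def axis_eq_axis)
  interpret product_sigma_finite "\<lambda>b :: real ^ 'n. lborel :: real measure"
    by standard
  define F where "F g = (\<Prod>b\<in>Basis. f (ix b) (g b))" for g :: "real ^ 'n \<Rightarrow> real"
  have F: "F g = (\<Prod>l\<in>UNIV. f l ((\<Sum>b\<in>Basis. g b *\<^sub>R b) $ l))" for g
  proof -
    have "(\<Sum>b\<in>Basis. g b *\<^sub>R b) $ l = g (axis l 1)" for l
    proof -
      have "(\<Sum>b\<in>Basis. g b *\<^sub>R b) $ l = (\<Sum>i\<in>UNIV. g (axis i 1) * (axis i 1 $ l))"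
        unfolding B by (subst sum.reindex[OF inj]) simp
      also have "\<dots> = (\<Sum>i\<in>UNIV. if i = l then g (axis l 1) else 0)"
        by (intro sum.cong) (auto simp: axis_def)
      finally show ?thesis by simp
    qed
    then show ?thesis
      unfolding F_def B by (subst prod.reindex[OF inj]) (simp add: ix)
  qed
  have meas: "(\<lambda>x :: real ^ 'n. \<Prod>l\<in>UNIV. f l (x $ l)) \<in> borel_measurable borel"
    by measurable
  have "integral\<^sup>L lborel (\<lambda>x :: real ^ 'n. \<Prod>l\<in>UNIV. f l (x $ l)) = integral\<^sup>L (\<Pi>\<^sub>M b\<in>Basis. lborel) F"
    unfolding F by (subst lborel_eq, subst integral_distr) (simp_all add: meas)
  also have "\<dots> = (\<Prod>b\<in>(Basis :: (real ^ 'n) set). integral\<^sup>L lborel (f (ix b)))"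
    unfolding F_def by (rule product_integral_prod) (simp_all add: int)
  also have "\<dots> = (\<Prod>l\<in>UNIV. integral\<^sup>L lborel (f l))"
    unfolding B by (subst prod.reindex[OF inj]) (simp add: ix)
  finally show "integral\<^sup>L lborel (\<lambda>x :: real ^ 'n. \<Prod>l\<in>UNIV. f l (x $ l)) = (\<Prod>l\<in>UNIV. integral\<^sup>L lborel (f l))" .
  have "integrable (\<Pi>\<^sub>M b\<in>Basis. lborel) F"
    unfolding F_def by (rule product_integrable_prod) (simp_all add: int)
  then show "integrable lborel (\<lambda>x :: real ^ 'n. \<Prod>l\<in>UNIV. f l (x $ l))"
    unfolding F by (subst lborel_eq, subst integrable_distr_eq) (simp_all add: meas)
qed

lemma finite_cube_index: "finite (cube_index K :: (nat ^ 'n::finite) set)"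
proof -
  have "finite ((\<lambda>f. \<chi> l. f l) ` (UNIV \<rightarrow>\<^sub>E {..K}) :: (nat ^ 'n) set)"
    by (intro finite_imageI finite_PiE) auto
  moreover have "(cube_index K :: (nat ^ 'n) set) \<subseteq> (\<lambda>f. \<chi> l. f l) ` (UNIV \<rightarrow>\<^sub>E {..K})"
  proof
    fix m :: "nat ^ 'n" assume "m \<in> cube_index K"
    then show "m \<in> (\<lambda>f. \<chi> l. f l) ` (UNIV \<rightarrow>\<^sub>E {..K})"
      by (intro image_eqI[of _ _ "\<lambda>l. m $ l"]) (auto simp: cube_index_def PiE_def)
  qed
  ultimately show ?thesis by (rule rev_finite_subset)
qed

lemma sum_cube_index_prod:
  fixes f :: "'n::finite \<Rightarrow> nat \<Rightarrow> real"
  shows "(\<Sum>m\<in>cube_index K. \<Prod>l\<in>UNIV. f l (m $ l)) = (\<Prod>l\<in>UNIV. \<Sum>i\<le>K. f l i)"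
proof -
  have "(\<Prod>l\<in>UNIV. \<Sum>i\<le>K. f l i) = (\<Sum>g\<in>UNIV \<rightarrow>\<^sub>E {..K}. \<Prod>l\<in>UNIV. f l (g l))"
    by (rule prod_sum_PiE) auto
  also have "\<dots> = (\<Sum>m\<in>cube_index K. \<Prod>l\<in>UNIV. f l (m $ l))"
    by (rule sum.reindex_bij_witness[where i = "\<lambda>m l. m $ l" and j = "\<lambda>g. \<chi> l. g l"])
      (auto simp: cube_index_def PiE_def)
  finally show ?thesis by simp
qed

lemma hyp_index_subset_cube: "(hyp_index K :: (nat ^ 'n::finite) set) \<subseteq> cube_index K"
proof
  fix k :: "nat ^ 'n" assume "k \<in> hyp_index K"
  then have k: "(\<Prod>l\<in>UNIV. 1 + k $ l) \<le> K + 1" by (simp add: hyp_index_def)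
  have "1 + k $ l \<le> (\<Prod>l\<in>UNIV. 1 + k $ l)" for l
    by (intro dvd_imp_le dvd_prodI) auto
  then have "k $ l \<le> K" for l
    using k order.trans[of "1 + k $ l" _ "K + 1"] by fastforce
  then show "k \<in> cube_index K" by (simp add: cube_index_def)
qed

lemma finite_hyp_index: "finite (hyp_index K :: (nat ^ 'n::finite) set)"
  using hyp_index_subset_cube finite_cube_index by (rule finite_subset)

lemma hyp_index_two:
  assumes "k \<in> hyp_index K" "l \<noteq> (m :: 'n::finite)"
  shows "(1 + k $ l) * (1 + k $ m) \<le> K + 1"
proof -
  have "(1 + k $ l) * (1 + k $ m) = (\<Prod>i\<in>{l, m}. 1 + k $ i)"
    using assms(2) by simp
  also have "\<dots> \<le> (\<Prod>i\<in>UNIV. 1 + k $ i)"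
    by (intro dvd_imp_le prod_dvd_prod_subset) auto
  also have "\<dots> \<le> K + 1"
    using assms(1) by (simp add: hyp_index_def)
  finally show ?thesis .
qed

section \<open>Both matrices as sums of tensor products of univariate entries\<close>

lemma galerkin_matrix_cheb:
  fixes \<R> :: "(nat ^ 'n::finite) set"
  shows "galerkin_matrix (cheb_expansion L \<R> a) j k =
    complex_of_real (\<Sum>r\<in>\<R>. a r * (\<Prod>l\<in>UNIV. exact_entry L (r $ l) (j $ l) (k $ l)))"
proof -
  define f where "f r l x = poly (hermite_normed (j $ l) * hermite_normed (k $ l)
     * scaled_chebyshev L (r $ l)) x * exp (- x\<^sup>2)" for r :: "nat ^ 'n" and l and x :: real
  have int: "integrable lborel (f r l)" for r l
    unfolding f_def by (rule integrable_poly_gauss)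
  have intp: "integrable lborel (\<lambda>x :: real ^ 'n. \<Prod>l\<in>UNIV. f r l (x $ l))" for r
    by (rule lborel_integral_prod(2)[OF int])
  have *: "hermite_fun j x * (cheb_expansion L \<R> a x * hermite_fun k x) =
      (\<Sum>r\<in>\<R>. a r * (\<Prod>l\<in>UNIV. f r l (x $ l)))" for x
  proof -
    have "hermite_fun1 (j $ l) (x $ l) * hermite_fun1 (k $ l) (x $ l) * poly (chebyshev_poly (r $ l)) (x $ l / L)
        = f r l (x $ l)" for r l
      unfolding hermite_fun1_mult by (simp add: f_def poly_scaled_chebyshev)
    then have prod: "hermite_fun j x * hermite_fun k x * (\<Prod>l\<in>UNIV. poly (chebyshev_poly (r $ l)) (x $ l / L))
        = (\<Prod>l\<in>UNIV. f r l (x $ l))" for r :: "nat ^ 'n"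
      by (simp add: hermite_fun_def flip: prod.distrib)
    show ?thesis
      unfolding cheb_expansion_def sum_distrib_left sum_distrib_right
      by (intro sum.cong refl) (simp only: prod[symmetric] mult_ac)
  qed
  have "galerkin_matrix (cheb_expansion L \<R> a) j k =
      (LINT x|lborel. complex_of_real (hermite_fun j x * (cheb_expansion L \<R> a x * hermite_fun k x)))"
    by (simp add: galerkin_matrix_def l2_inner_def)
  also have "\<dots> = complex_of_real (LINT x|lborel. hermite_fun j x * (cheb_expansion L \<R> a x * hermite_fun k x))"
    by (rule integral_complex_of_real)
  also have "(LINT x|lborel. hermite_fun j x * (cheb_expansion L \<R> a x * hermite_fun k x)) =
      (\<Sum>r\<in>\<R>. a r * (LINT x|lborel. (\<Prod>l\<in>UNIV. f r l ((x :: real ^ 'n) $ l))))"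
    unfolding * by (subst Bochner_Integration.integral_sum) (simp_all add: intp)
  also have "\<dots> = (\<Sum>r\<in>\<R>. a r * (\<Prod>l\<in>UNIV. exact_entry L (r $ l) (j $ l) (k $ l)))"
    unfolding lborel_integral_prod(1)[OF int] by (simp add: exact_entry_def herm_int_def f_def[abs_def])
  finally show ?thesis .
qed

text \<open>The factor exp(xi^2) in each grid weight cancels the Gaussian of the two Hermite
  functions, leaving the polynomial rule \<open>gauss_sum\<close>; the sum over the full grid then
  factorises.\<close>

lemma gh_matrix_cheb:
  fixes \<R> :: "(nat ^ 'n::finite) set"
  shows "gh_matrix K (cheb_expansion L \<R> a) j k =
    complex_of_real (\<Sum>r\<in>\<R>. a r * (\<Prod>l\<in>UNIV. quad_entry K L (r $ l) (j $ l) (k $ l)))"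
proof -
  define f where "f r l i = gh_weight K i * poly (hermite_normed (j $ l) * hermite_normed (k $ l)
     * scaled_chebyshev L (r $ l)) (gh_node K i)" for r :: "nat ^ 'n" and l i
  have *: "gh_grid_weight K m * hermite_fun j (gh_grid_node K m)
        * cheb_expansion L \<R> a (gh_grid_node K m) * hermite_fun k (gh_grid_node K m)
      = (\<Sum>r\<in>\<R>. a r * (\<Prod>l\<in>UNIV. f r l (m $ l)))" for m
  proof -
    define x where "x = gh_grid_node K m"
    have x: "x $ l = gh_node K (m $ l)" for l
      by (simp add: x_def gh_grid_node_def)
    have "gh_weight K (m $ l) * exp ((gh_node K (m $ l))\<^sup>2) *
        (hermite_fun1 (j $ l) (x $ l) * hermite_fun1 (k $ l) (x $ l)) * poly (chebyshev_poly (r $ l)) (x $ l / L)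
        = f r l (m $ l)" for r l
      unfolding hermite_fun1_mult by (simp add: f_def x poly_scaled_chebyshev exp_minus)
    then have prod: "gh_grid_weight K m * (hermite_fun j x * hermite_fun k x)
         * (\<Prod>l\<in>UNIV. poly (chebyshev_poly (r $ l)) (x $ l / L))
        = (\<Prod>l\<in>UNIV. f r l (m $ l))" for r :: "nat ^ 'n"
      by (simp add: hermite_fun_def gh_grid_weight_def flip: prod.distrib)
    show ?thesis
      unfolding cheb_expansion_def sum_distrib_left sum_distrib_right x_def[symmetric]
      by (intro sum.cong refl) (simp only: prod[symmetric] mult_ac)
  qed
  have "(\<Sum>m\<in>cube_index K. \<Sum>r\<in>\<R>. a r * (\<Prod>l\<in>UNIV. f r l (m $ l))) =
      (\<Sum>r\<in>\<R>. a r * (\<Sum>m\<in>cube_index K. \<Prod>l\<in>UNIV. f r l (m $ l)))"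
    by (subst sum.swap) (simp add: sum_distrib_left)
  also have "\<dots> = (\<Sum>r\<in>\<R>. a r * (\<Prod>l\<in>UNIV. quad_entry K L (r $ l) (j $ l) (k $ l)))"
    unfolding sum_cube_index_prod by (simp add: quad_entry_def gauss_sum_def f_def)
  finally show ?thesis
    unfolding gh_matrix_def * by simp
qed

subsection \<open>The multivariate error\<close>

text \<open>If 2(1 + k_l) > K + 1, a second nonzero coordinate, which contributes a factor of at
  least 2, would violate the hyperbolic bound.\<close>

lemma hyp_index_concentrated:
  assumes "k \<in> hyp_index K" "K < 2 * k $ l + 1" "m \<noteq> (l :: 'n::finite)"
  shows "k $ m = 0"
proof (rule ccontr)
  assume "k $ m \<noteq> 0"
  then have "(1 + k $ l) * 2 \<le> (1 + k $ l) * (1 + k $ m)"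
    by (intro mult_le_mono2) simp
  also have "\<dots> \<le> K + 1"
    using assms by (intro hyp_index_two) auto
  finally show False using assms(2) by simp
qed

text \<open>One inexact entry in direction l, for whatever k, forces j_l >= K + 2 - R and hence j_m
  = 0 for all other m. So the critical direction depends on j alone and serves all k at once. The
  contributing k lie on the l-axis, which reduces the sum to
  \<open>weighted_entry_error_bound\<close>.\<close>

lemma tensor_error_bound:
  fixes \<beta> K R :: nat and r j :: "nat ^ 'n::finite"
  assumes K: "real K \<ge> (1300 + 15 * real \<beta>) * real R" and L: "L \<ge> sqrt (2 * (real K + 1)) + 1"
    and r: "r \<in> cube_index R" and j: "j \<in> hyp_index K"
  shows "(\<Sum>k\<in>hyp_index K.
      \<bar>(\<Prod>l\<in>UNIV. exact_entry L (r $ l) (j $ l) (k $ l))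
        - (\<Prod>l\<in>UNIV. quad_entry K L (r $ l) (j $ l) (k $ l))\<bar>
      * (\<Prod>l\<in>UNIV. 1 / real (max (k $ l) 1) ^ \<beta>))
    \<le> cheb_const (r_max r) / real K ^ \<beta>"
proof -
  define E where "E k l = exact_entry L (r $ l) (j $ l) (k $ l)" for k :: "nat ^ 'n" and l
  define Q where "Q k l = quad_entry K L (r $ l) (j $ l) (k $ l)" for k :: "nat ^ 'n" and l
  define w where "w k = (\<Prod>l\<in>UNIV. 1 / real (max (k $ l) 1) ^ \<beta>)" for k :: "nat ^ 'n"
  have le: "k $ l \<le> K" if "k \<in> hyp_index K" for k :: "nat ^ 'n" and l
    using that hyp_index_subset_cube[of K] by (auto simp: cube_index_def)
  have rR: "r $ l \<le> R" for l
    using r by (simp add: cube_index_def)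
  have KR: "real K \<ge> 1300 * real R"
    using K mult_nonneg_nonneg[of "15 * real \<beta>" "real R"] unfolding distrib_right by linarith
  have exact: "E k l = Q k l" if "j $ l + k $ l + r $ l \<le> 2 * K + 1" for k l
    unfolding E_def Q_def by (rule quad_entry_exact[OF that, symmetric])
  have "(\<Sum>k\<in>hyp_index K. \<bar>prod (E k) UNIV - prod (Q k) UNIV\<bar> * w k) \<le> cheb_const (r_max r) / real K ^ \<beta>"
  proof (cases "\<exists>k\<in>hyp_index K. \<exists>l. j $ l + k $ l + r $ l > 2 * K + 1")
    case False
    then have "E k l = Q k l" if "k \<in> hyp_index K" for k l
      using that by (intro exact) (meson not_le)
    then have "prod (E k) UNIV = prod (Q k) UNIV" if "k \<in> hyp_index K" for k
      using that by (intro prod.cong) auto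
    then have "(\<Sum>k\<in>hyp_index K. \<bar>prod (E k) UNIV - prod (Q k) UNIV\<bar> * w k) = 0"
      by (intro sum.neutral) simp
    then show ?thesis
      using cheb_const_nonneg by simp
  next
    case True
    then obtain k0 l where k0: "k0 \<in> hyp_index K" "j $ l + k0 $ l + r $ l > 2 * K + 1" by blast
    then have jl: "j $ l + R \<ge> K + 2"
      using le[OF k0(1), of l] rR[of l] by linarith
    then have "R \<ge> 2"
      using le[OF j, of l] by linarith
    have conc: "k $ m = 0" if "k \<in> hyp_index K" "k $ l + R \<ge> K + 2" "m \<noteq> l" for k :: "nat ^ 'n" and m
      using that KR by (intro hyp_index_concentrated[of k K l m]) linarith+
    have jm: "j $ m = 0" if "m \<noteq> l" for m
      using conc[OF j jl that] .
    \<comment> \<open>Off the critical direction j_m = 0, so the degree is at most K + R <= 2K + 1,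
      for every k in the index set.\<close>
    have exact_m: "E k m = Q k m" if "k \<in> hyp_index K" "m \<noteq> l" for k m
      using jm[OF that(2)] le[OF that(1), of m] rR[of m] KR by (intro exact) linarith
    define A where "A = {k \<in> hyp_index K. \<forall>m. m \<noteq> l \<longrightarrow> k $ m = 0}"
    define g where "g i = \<bar>exact_entry L (r $ l) (j $ l) i - quad_entry K L (r $ l) (j $ l) i\<bar>
        / real (max i 1) ^ \<beta>" for i
    have finA: "finite A" unfolding A_def using finite_hyp_index[of K] by (rule rev_finite_subset) auto
    have g0: "g i \<ge> 0" for i by (simp add: g_def)
    have "\<bar>prod (E k) UNIV - prod (Q k) UNIV\<bar> * w k \<le> (if k \<in> A then g (k $ l) else 0)"
      if k: "k \<in> hyp_index K" for k
    proof (cases "j $ l + k $ l + r $ l \<le> 2 * K + 1")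
      case True
      then have "E k m = Q k m" for m
        using exact exact_m[OF k] by (cases "m = l") auto
      then have "prod (E k) UNIV = prod (Q k) UNIV"
        by (intro prod.cong) auto
      then show ?thesis using g0 by simp
    next
      case False
      then have "k $ l + R \<ge> K + 2"
        using le[OF j, of l] rR[of l] by linarith
      then have km: "k $ m = 0" if "m \<noteq> l" for m
        using conc[OF k] that by blast
      then have kA: "k \<in> A" using k by (simp add: A_def)
      have split: "prod f UNIV = f l * prod f (UNIV - {l})" for f :: "'n \<Rightarrow> real"
        by (rule prod.remove) auto
      have "prod (E k) (UNIV - {l}) = prod (Q k) (UNIV - {l})"
        using exact_m[OF k] by (intro prod.cong) auto
      then have "\<bar>prod (E k) UNIV - prod (Q k) UNIV\<bar> = \<bar>E k l - Q k l\<bar> * \<bar>prod (Q k) (UNIV - {l})\<bar>"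
        unfolding split[of "E k"] split[of "Q k"] by (simp flip: left_diff_distrib abs_mult)
      also have "\<bar>prod (Q k) (UNIV - {l})\<bar> \<le> 1"
        unfolding abs_prod Q_def using le[OF j] le[OF k] L
        by (intro prod_le_1) (auto intro: quad_entry_le_one)
      then have "\<bar>E k l - Q k l\<bar> * \<bar>prod (Q k) (UNIV - {l})\<bar> \<le> \<bar>E k l - Q k l\<bar>"
        by (simp add: mult_left_le)
      finally have D: "\<bar>prod (E k) UNIV - prod (Q k) UNIV\<bar> \<le> \<bar>E k l - Q k l\<bar>" .
      have "w k = 1 / real (max (k $ l) 1) ^ \<beta> * (\<Prod>m\<in>UNIV - {l}. 1 / real (max (k $ m) 1) ^ \<beta>)"
        unfolding w_def by (rule split)
      also have "(\<Prod>m\<in>UNIV - {l}. 1 / real (max (k $ m) 1) ^ \<beta>) = 1"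
        using km by (intro prod.neutral) auto
      finally have w: "w k = 1 / real (max (k $ l) 1) ^ \<beta>" by simp
      have "\<bar>prod (E k) UNIV - prod (Q k) UNIV\<bar> * w k \<le> \<bar>E k l - Q k l\<bar> * w k"
        using D by (intro mult_right_mono) (simp_all add: w)
      then show ?thesis
        using kA by (simp add: w g_def E_def Q_def)
    qed
    then have "(\<Sum>k\<in>hyp_index K. \<bar>prod (E k) UNIV - prod (Q k) UNIV\<bar> * w k)
        \<le> (\<Sum>k\<in>hyp_index K. if k \<in> A then g (k $ l) else 0)"
      by (rule sum_mono)
    also have "\<dots> = (\<Sum>k\<in>A. g (k $ l))"
      by (rule sum.mono_neutral_cong_right) (auto simp: A_def finite_hyp_index)
    \<comment> \<open>On \<open>A\<close> all coordinates other than l vanish, so k is determined by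
      k_l and the sum becomes univariate.\<close>
    also have "\<dots> = (\<Sum>i\<in>(\<lambda>k. k $ l) ` A. g i)"
    proof -
      have "inj_on (\<lambda>k. k $ l) A"
        by (auto simp: inj_on_def A_def vec_eq_iff) metis
      then show ?thesis by (simp add: sum.reindex)
    qed
    also have "\<dots> \<le> (\<Sum>i\<le>K. g i)"
      using le g0 by (intro sum_mono2) (auto simp: A_def)
    also have "\<dots> \<le> cheb_const (r $ l) / real K ^ \<beta>"
    proof -
      have "(1300 + 15 * real \<beta>) * real (r $ l) \<le> (1300 + 15 * real \<beta>) * real R"
        using rR by (intro mult_left_mono) auto
      then show ?thesis
        unfolding g_def using K L le[OF j, of l] by (intro weighted_entry_error_bound) linarith+
    qed
    also have "\<dots> \<le> cheb_const (r_max r) / real K ^ \<beta>"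
      unfolding r_max_def by (intro divide_right_mono cheb_const_mono Max_ge) auto
    finally show ?thesis .
  qed
  then show ?thesis
    by (simp add: E_def Q_def w_def)
qed

lemma quad_const_eq: "quad_const \<R> a = (\<Sum>r\<in>\<R>. \<bar>a r\<bar> * cheb_const (r_max r))"
  by (simp add: quad_const_def cheb_const_def)

lemma quadrature_error_bound:
  fixes \<R> :: "(nat ^ 'n::finite) set" and v :: "nat ^ 'n \<Rightarrow> complex"
  assumes \<R>: "\<R> \<subseteq> cube_index R" and K: "real K \<ge> (1300 + 15 * real \<beta>) * real R"
    and L: "L \<ge> sqrt (2 * (real K + 1)) + 1"
    and v: "\<And>k. k \<in> hyp_index K \<Longrightarrow> norm (v k) \<le> M * (\<Prod>l\<in>UNIV. 1 / real (max (k $ l) 1) ^ \<beta>)"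
    and j: "j \<in> hyp_index K"
  shows "norm (\<Sum>k\<in>hyp_index K.
      (galerkin_matrix (cheb_expansion L \<R> a) j k - gh_matrix K (cheb_expansion L \<R> a) j k) * v k)
    \<le> M * quad_const \<R> a / real K ^ \<beta>"
proof -
  define d where "d r k = (\<Prod>l\<in>UNIV. exact_entry L (r $ l) (j $ l) (k $ l))
      - (\<Prod>l\<in>UNIV. quad_entry K L (r $ l) (j $ l) (k $ l))" for r k :: "nat ^ 'n"
  define w where "w k = (\<Prod>l\<in>UNIV. 1 / real (max (k $ l) 1) ^ \<beta>)" for k :: "nat ^ 'n"
  \<comment> \<open>At k = 0 the decay weight is 1, so the hypothesis on \<open>v\<close> itself
    yields M >= 0.\<close>
  have "(0 :: nat ^ 'n) \<in> hyp_index K" by (simp add: hyp_index_def)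
  from v[OF this] have "norm (v 0) \<le> M" by simp
  then have M: "M \<ge> 0"
    using norm_ge_zero[of "v 0"] by (rule order.trans[rotated])
  have diff: "galerkin_matrix (cheb_expansion L \<R> a) j k - gh_matrix K (cheb_expansion L \<R> a) j k
      = complex_of_real (\<Sum>r\<in>\<R>. a r * d r k)" for k
    unfolding galerkin_matrix_cheb gh_matrix_cheb d_def
    by (simp only: right_diff_distrib sum_subtractf of_real_diff)
  have "norm (\<Sum>k\<in>hyp_index K.
      (galerkin_matrix (cheb_expansion L \<R> a) j k - gh_matrix K (cheb_expansion L \<R> a) j k) * v k)
      \<le> (\<Sum>k\<in>hyp_index K. (\<Sum>r\<in>\<R>. \<bar>a r\<bar> * \<bar>d r k\<bar>) * (M * w k))"
  proof (rule sum_norm_le)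
    fix k :: "nat ^ 'n" assume k: "k \<in> hyp_index K"
    have "\<bar>\<Sum>r\<in>\<R>. a r * d r k\<bar> \<le> (\<Sum>r\<in>\<R>. \<bar>a r\<bar> * \<bar>d r k\<bar>)"
      by (rule order.trans[OF sum_abs]) (simp add: abs_mult)
    then show "norm ((galerkin_matrix (cheb_expansion L \<R> a) j k - gh_matrix K (cheb_expansion L \<R> a) j k) * v k)
        \<le> (\<Sum>r\<in>\<R>. \<bar>a r\<bar> * \<bar>d r k\<bar>) * (M * w k)"
      unfolding norm_mult diff norm_of_real w_def using v[OF k]
      by (intro mult_mono) (auto intro: sum_nonneg)
  qed
  also have "\<dots> = (\<Sum>k\<in>hyp_index K. \<Sum>r\<in>\<R>. M * (\<bar>a r\<bar> * (\<bar>d r k\<bar> * w k)))"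
    unfolding sum_distrib_right by (intro sum.cong refl) (simp only: mult_ac)
  also have "\<dots> = M * (\<Sum>r\<in>\<R>. \<bar>a r\<bar> * (\<Sum>k\<in>hyp_index K. \<bar>d r k\<bar> * w k))"
    by (subst sum.swap) (simp only: sum_distrib_left)
  also have "\<dots> \<le> M * (\<Sum>r\<in>\<R>. \<bar>a r\<bar> * (cheb_const (r_max r) / real K ^ \<beta>))"
    unfolding d_def w_def using \<R> K L j M
    by (intro mult_left_mono sum_mono tensor_error_bound) auto
  also have "\<dots> = M * quad_const \<R> a / real K ^ \<beta>"
    by (simp add: quad_const_eq flip: sum_divide_distrib)
  finally show ?thesis .
qed

text \<open>K >> R is quantified as K >= rho * R with rho chosen before all other data, hence
  uniformly in R, K, L, t, W, the coefficients and v. The implied constant of the decay assumption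
  is \<open>M\<close>; it enters the estimate as a factor, so that \<open>quad_const\<close> is the
  stated expression without a further constant.\<close>

theorem theorem1:
  fixes \<beta> :: nat
  shows "\<exists>\<rho>>0. \<forall>(R::nat) (K::nat) (L::real) (t::real) (M::real) (\<R> :: (nat ^ 'n::finite) set)
      (W :: real ^ 'n \<Rightarrow> real \<Rightarrow> real) (\<alpha> :: nat ^ 'n \<Rightarrow> real \<Rightarrow> real) (v :: nat ^ 'n \<Rightarrow> complex).
    \<R> \<subseteq> cube_index R \<longrightarrow>
    real K \<ge> \<rho> * real R \<longrightarrow>
    L \<ge> sqrt (2 * (real K + 1)) + 1 \<longrightarrow>
    continuous_on {x. \<forall>l. x $ l \<in> {-L..L}} (\<lambda>x. W x t) \<longrightarrow>
    chebyshev_interpolation L \<R> (\<lambda>x. W x t) (\<lambda>r. \<alpha> r t) \<longrightarrow>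
    (\<forall>k\<in>hyp_index K.
       norm (v k) \<le> M * (\<Prod>l\<in>UNIV. real (max (k $ l) 1) powi (- int \<beta>))) \<longrightarrow>
    (\<forall>j\<in>hyp_index K.
       norm (\<Sum>k\<in>hyp_index K.
          (galerkin_matrix (cheb_expansion L \<R> (\<lambda>r. \<alpha> r t)) j k
            - gh_matrix K (cheb_expansion L \<R> (\<lambda>r. \<alpha> r t)) j k) * v k)
       \<le> M * quad_const \<R> (\<lambda>r. \<alpha> r t) * real K powi (- int \<beta>))"
proof -
  \<comment> \<open>This includes n = 0, where division by zero yields 0 for positive beta. K = 0
    forces R = 0, and then the rule is exact and the constant is 0.\<close>
  have powi: "real n powi (- int \<beta>) = 1 / real n ^ \<beta>" for n
    by (simp add: power_int_minus divide_inverse)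
  show ?thesis
    unfolding powi
  proof (intro exI[of _ "1300 + 15 * real \<beta>"] conjI allI impI ballI)
    show "1300 + 15 * real \<beta> > 0" by simp
  next
    fix R K :: nat and L t M :: real and \<R> :: "(nat ^ 'n) set"
      and \<alpha> :: "nat ^ 'n \<Rightarrow> real \<Rightarrow> real" and v :: "nat ^ 'n \<Rightarrow> complex" and j :: "nat ^ 'n"
    assume "\<R> \<subseteq> cube_index R" "real K \<ge> (1300 + 15 * real \<beta>) * real R"
      "L \<ge> sqrt (2 * (real K + 1)) + 1" "j \<in> hyp_index K"
      "\<forall>k\<in>hyp_index K. norm (v k) \<le> M * (\<Prod>l\<in>UNIV. 1 / real (max (k $ l) 1) ^ \<beta>)"
    then show "norm (\<Sum>k\<in>hyp_index K.
          (galerkin_matrix (cheb_expansion L \<R> (\<lambda>r. \<alpha> r t)) j k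
            - gh_matrix K (cheb_expansion L \<R> (\<lambda>r. \<alpha> r t)) j k) * v k)
       \<le> M * quad_const \<R> (\<lambda>r. \<alpha> r t) * (1 / real K ^ \<beta>)"
      using quadrature_error_bound[of \<R> R \<beta> K L v M j "\<lambda>r. \<alpha> r t"] by simp
  qed
qed

end
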